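(* Let $\alpha\in(0,1)$ be fixed. For each $n$, let $\mu_1,\dots,\mu_n$ be i.i.d. $\mathcal{N}(0,1)$, let $\sigma_1,\dots,\sigma_n$ be i.i.d. and independent of the $\mu_i$ with $\mathbb{P}(\sigma_i=1)=\mathbb{P}(\sigma_i=2)=1/2$, and let $X_i\mid\mu_i,\sigma_i\sim\mathcal{N}(\mu_i,\sigma_i^2)$ independently across $i$. Consider the parametric family of priors $G(\eta)=\mathcal{N}(\eta,1)$, $\eta\in\mathbb{R}$ (so the true parameter is $\eta_0=0$), let $\widehat\eta$ be the maximum likelihood estimator of $\eta$ from $(X_1,\sigma_1),\dots,(X_n,\sigma_n)$, and use $\widehat G=G(\widehat\eta)$ as the empirical Bayes prior to select $m=\lfloor\alpha n\rfloor$ units. Then there is a constant $C>0$ such that the regret $\mathcal{R}$ of empirical Bayes selection relative to oracle Bayes selection satisfies $\mathcal{R}\ge Cn^{-1}$ with non-vanishing probability, i.e. $$\liminf_{n\to\infty}\mathbb{P}\left(\mathcal{R}\ge C n^{-1}\right)>0 .$$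
   Context: Under prior $\mathcal{N}(\eta,1)$, marginally $X_i\mid\sigma_i\sim\mathcal{N}(\eta,1+\sigma_i^2)$ independently, and $\widehat\eta$ maximizes the corresponding likelihood in $\eta$. The oracle Bayes posterior mean is $\theta_i=\frac{1}{\sigma_i^2+1}X_i$ and the empirical Bayes posterior mean is $\widehat\theta_i=\frac{1}{\sigma_i^2+1}X_i+\frac{\sigma_i^2}{\sigma_i^2+1}\widehat\eta$. $J_{\mathrm{Bayes}}$ is the set of indices of the $m$ largest $\theta_i$, and $J_{\mathrm{EB}}$ the set of indices of the $m$ largest $\widehat\theta_i$, ties broken randomly. The regret is $$\mathcal{R}=\frac1n\sum_{i=1}^n\left(\mathds{1}(i\in J_{\mathrm{Bayes}})-\mathds{1}(i\in J_{\mathrm{EB}})\right)\theta_i .$$ *)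

theory Defs
  imports "HOL-Probability.Probability" "HOL-Combinatorics.Permutations"
begin

text \<open>
  Units are indexed by \<open>{1..n}\<close>. The conditional law of the observations given
  \<open>(\<mu>, \<sigma>)\<close> is expressed by a regular version of the conditional probability of
  measurable rectangles: the conditional probability of \<open>X\<^sub>i \<in> A\<^sub>i\<close> for all \<open>i\<close>
  is the product of the \<open>N(\<mu>\<^sub>i, \<sigma>\<^sub>i\<^sup>2)\<close>-probabilities of the sets \<open>A\<^sub>i\<close>.
  Note that the second argument of \<^const>\<open>normal_density\<close> is the standard deviation.
\<close>

definition params ::
  "nat \<Rightarrow> (nat \<Rightarrow> 'a \<Rightarrow> real) \<Rightarrow> (nat \<Rightarrow> 'a \<Rightarrow> real) \<Rightarrow> 'a \<Rightarrow> nat \<Rightarrow> real \<times> real" where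
  "params n \<mu> \<sigma> \<omega> = (\<lambda>i\<in>{1..n}. (\<mu> i \<omega>, \<sigma> i \<omega>))"

locale normal_means_model = prob_space M for M :: "'a measure" +
  fixes n :: nat and \<mu> \<sigma> X :: "nat \<Rightarrow> 'a \<Rightarrow> real"
  assumes indep_\<mu>: "indep_vars (\<lambda>_. borel) \<mu> {1..n}"
    and distr_\<mu>: "\<And>i. i \<in> {1..n} \<Longrightarrow> distributed M lborel (\<mu> i) std_normal_density"
    and indep_\<sigma>: "indep_vars (\<lambda>_. borel) \<sigma> {1..n}"
    and distr_\<sigma>: "\<And>i. i \<in> {1..n} \<Longrightarrow>
          prob {\<omega> \<in> space M. \<sigma> i \<omega> = 1} = 1/2 \<and> prob {\<omega> \<in> space M. \<sigma> i \<omega> = 2} = 1/2"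
    and indep_\<mu>_\<sigma>:
      "indep_var (\<Pi>\<^sub>M i\<in>{1..n}. borel) (\<lambda>\<omega>. \<lambda>i\<in>{1..n}. \<mu> i \<omega>)
                 (\<Pi>\<^sub>M i\<in>{1..n}. borel) (\<lambda>\<omega>. \<lambda>i\<in>{1..n}. \<sigma> i \<omega>)"
    and measurable_X: "\<And>i. i \<in> {1..n} \<Longrightarrow> random_variable borel (X i)"
    and cond_law_X: "\<And>A. (\<And>i. i \<in> {1..n} \<Longrightarrow> A i \<in> sets borel) \<Longrightarrow>
      AE \<omega> in M.
        real_cond_exp M
          (vimage_algebra (space M) (params n \<mu> \<sigma>) (\<Pi>\<^sub>M i\<in>{1..n}. borel \<Otimes>\<^sub>M borel))
          (indicator {\<omega> \<in> space M. \<forall>i\<in>{1..n}. X i \<omega> \<in> A i}) \<omega>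
        = (\<Prod>i=1..n. measure (density lborel (normal_density (\<mu> i \<omega>) (\<sigma> i \<omega>))) (A i))"

text \<open>
  Under the prior \<open>N(\<eta>, 1)\<close>: the marginal density of an observation \<open>x\<close> with noise level
  \<open>s\<close>, and the posterior mean given \<open>x\<close>. The lemma below is Bayes' rule: prior times
  likelihood factors as marginal times posterior.
\<close>

definition marginal_density :: "real \<Rightarrow> real \<Rightarrow> real \<Rightarrow> real" where
  "marginal_density \<eta> s x = normal_density \<eta> (sqrt (1 + s\<^sup>2)) x"

definition posterior_mean :: "real \<Rightarrow> real \<Rightarrow> real \<Rightarrow> real" where
  "posterior_mean \<eta> s x = 1 / (s\<^sup>2 + 1) * x + s\<^sup>2 / (s\<^sup>2 + 1) * \<eta>"

lemma bayes_rule_normal: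
  assumes "s > 0"
  shows "normal_density \<eta> 1 t * normal_density t s x =
         marginal_density \<eta> s x *
         normal_density (posterior_mean \<eta> s x) (s / sqrt (1 + s\<^sup>2)) t"
proof -
  define q where "q = s\<^sup>2"
  define p where "p = posterior_mean \<eta> s x"
  have q: "q > 0" using assms by (simp add: q_def)
  have "p = (x + q * \<eta>) / (1 + q)"
    unfolding p_def posterior_mean_def q_def by (simp add: add_divide_distrib add.commute)
  then have x: "x = p * (1 + q) - q * \<eta>" using q by simp
  have "(x - \<eta>)\<^sup>2 = (1 + q)\<^sup>2 * (p - \<eta>)\<^sup>2"
    unfolding x by algebra
  moreover have "(1 + q)\<^sup>2 * a / (2 * (1 + q)) = (1 + q) * a / 2" for a
  proof -
    have "1 + q \<noteq> 0" using q by simp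
    then show ?thesis by (subst frac_eq_eq) (simp_all add: power2_eq_square mult_ac)
  qed
  ultimately have marg: "(x - \<eta>)\<^sup>2 / (2 * (1 + q)) = (1 + q) * (p - \<eta>)\<^sup>2 / 2"
    by simp
  have "q * (t - \<eta>)\<^sup>2 + (x - t)\<^sup>2 = q * ((1 + q) * (p - \<eta>)\<^sup>2) + (1 + q) * (t - p)\<^sup>2"
    unfolding x by algebra
  moreover have "(t - \<eta>)\<^sup>2 / 2 + (x - t)\<^sup>2 / (2 * q) = (q * (t - \<eta>)\<^sup>2 + (x - t)\<^sup>2) / (2 * q)"
    using q by (simp add: add_divide_distrib)
  ultimately have "(t - \<eta>)\<^sup>2 / 2 + (x - t)\<^sup>2 / (2 * q) =
      (1 + q) * (p - \<eta>)\<^sup>2 / 2 + (t - p)\<^sup>2 / (2 * (q / (1 + q)))"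
    using q by (simp add: add_divide_distrib)
  then have "- (t - \<eta>)\<^sup>2 / 2 + - (x - t)\<^sup>2 / (2 * q) =
      - (x - \<eta>)\<^sup>2 / (2 * (1 + q)) + - (t - p)\<^sup>2 / (2 * (q / (1 + q)))"
    using marg by simp
  then have e: "exp (- (t - \<eta>)\<^sup>2 / 2) * exp (- (x - t)\<^sup>2 / (2 * q)) =
      exp (- (x - \<eta>)\<^sup>2 / (2 * (1 + q))) * exp (- (t - p)\<^sup>2 / (2 * (q / (1 + q))))"
    by (simp only: exp_add [symmetric])
  have "sqrt (2 * pi * q) * sqrt (2 * pi) =
      sqrt (2 * pi * (1 + q)) * sqrt (2 * pi * (q / (1 + q)))"
    using q by (simp add: real_sqrt_mult [symmetric])
  then have c: "1 / sqrt (2 * pi) * (1 / sqrt (2 * pi * q)) =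
      1 / sqrt (2 * pi * (1 + q)) * (1 / sqrt (2 * pi * (q / (1 + q))))"
    by (simp add: mult.commute)
  have s: "(sqrt (1 + q))\<^sup>2 = 1 + q" "(s / sqrt (1 + q))\<^sup>2 = q / (1 + q)"
    using q by (simp_all add: power_divide q_def)
  have "normal_density \<eta> 1 t * normal_density t s x =
      (1 / sqrt (2 * pi) * (1 / sqrt (2 * pi * q))) *
      (exp (- (t - \<eta>)\<^sup>2 / 2) * exp (- (x - t)\<^sup>2 / (2 * q)))"
    by (simp add: normal_density_def q_def)
  also have "\<dots> = normal_density \<eta> (sqrt (1 + q)) x * normal_density p (s / sqrt (1 + q)) t"
    unfolding c e normal_density_def s by (simp only: mult_ac)
  finally show ?thesis unfolding marginal_density_def p_def q_def .
qed

text \<open>The factors \<open>P(\<sigma>\<^sub>i = s\<^sub>i)\<close> do not depend on \<open>\<eta>\<close> and are omitted.\<close>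

definition likelihood :: "nat \<Rightarrow> (nat \<Rightarrow> real) \<Rightarrow> (nat \<Rightarrow> real) \<Rightarrow> real \<Rightarrow> real" where
  "likelihood n s x \<eta> = (\<Prod>i=1..n. marginal_density \<eta> (s i) (x i))"

definition is_mle :: "nat \<Rightarrow> (nat \<Rightarrow> real) \<Rightarrow> (nat \<Rightarrow> real) \<Rightarrow> real \<Rightarrow> bool" where
  "is_mle n s x \<eta> \<longleftrightarrow> is_arg_max (likelihood n s x) (\<lambda>_. True) \<eta>"

text \<open>
  The indices of the \<open>m\<close> largest scores among \<open>{1..n}\<close>: those beaten by fewer than \<open>m\<close>
  others, where among equal scores the smaller value of \<open>\<pi>\<close> wins.
\<close>

definition top_indices ::
  "nat \<Rightarrow> nat \<Rightarrow> (nat \<Rightarrow> nat) \<Rightarrow> (nat \<Rightarrow> real) \<Rightarrow> nat set" where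
  "top_indices n m \<pi> \<theta> =
    {i \<in> {1..n}. card {j \<in> {1..n}. \<theta> i < \<theta> j \<or> \<theta> i = \<theta> j \<and> \<pi> j < \<pi> i} < m}"

lemma top_indices_larger:
  assumes "i \<in> top_indices n m \<pi> \<theta>" "j \<in> {1..n} - top_indices n m \<pi> \<theta>"
  shows "\<theta> j \<le> \<theta> i"
proof (rule ccontr)
  let ?B = "\<lambda>i. {j \<in> {1..n}. \<theta> i < \<theta> j \<or> \<theta> i = \<theta> j \<and> \<pi> j < \<pi> i}"
  assume "\<not> \<theta> j \<le> \<theta> i"
  then have "?B j \<subseteq> ?B i" by auto
  then have "card (?B j) \<le> card (?B i)" by (intro card_mono) auto
  then show False using assms by (auto simp: top_indices_def)
qed

lemma card_top_indices:
  assumes "inj_on \<pi> {1..n}" "m \<le> n"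
  shows "card (top_indices n m \<pi> \<theta>) = m"
proof -
  define B where "B = (\<lambda>i. {j \<in> {1..n}. \<theta> i < \<theta> j \<or> \<theta> i = \<theta> j \<and> \<pi> j < \<pi> i})"
  have top: "top_indices n m \<pi> \<theta> = {i \<in> {1..n}. card (B i) < m}"
    by (simp add: top_indices_def B_def)
  have B_sub: "B i \<subseteq> {1..n}" and B_irrefl: "i \<notin> B i" for i
    unfolding B_def by blast simp
  have fin: "finite (B i)" for i
    using B_sub by (rule finite_subset) simp
  have less: "card (B i) < card (B j)" if "i \<in> B j" for i j
  proof -
    have "B i \<subseteq> B j" using that unfolding B_def by auto
    then have "B i \<subset> B j" using that B_irrefl[of i] by blast
    then show ?thesis using fin by (rule psubset_card_mono[rotated])
  qed
  have inj: "inj_on (\<lambda>i. card (B i)) {1..n}"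
  proof (rule inj_onI, rule ccontr)
    fix i j assume ij: "i \<in> {1..n}" "j \<in> {1..n}" "card (B i) = card (B j)" "i \<noteq> j"
    then have "\<pi> i \<noteq> \<pi> j" using assms(1) by (metis inj_onD)
    then have "(\<theta> j < \<theta> i \<or> \<theta> j = \<theta> i \<and> \<pi> i < \<pi> j) \<or> (\<theta> i < \<theta> j \<or> \<theta> i = \<theta> j \<and> \<pi> j < \<pi> i)"
      by linarith
    then have "i \<in> B j \<or> j \<in> B i" using ij(1,2) unfolding B_def by blast
    then show False using less[of i j] less[of j i] ij(3) by linarith
  qed
  have "card (B i) < n" if "i \<in> {1..n}" for i
  proof -
    have "B i \<subset> {1..n}" using B_sub[of i] B_irrefl[of i] that by blast
    then have "card (B i) < card {1..n}" by (rule psubset_card_mono[rotated]) simp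
    then show ?thesis by simp
  qed
  then have img: "(\<lambda>i. card (B i)) ` {1..n} = {..<n}"
    using inj by (intro card_subset_eq) (auto simp: card_image)
  have "(\<lambda>i. card (B i)) ` top_indices n m \<pi> \<theta> = {..<n} \<inter> {..<m}"
    unfolding top img[symmetric] by blast
  also have "\<dots> = {..<m}" using assms(2) by auto
  finally have "card ((\<lambda>i. card (B i)) ` top_indices n m \<pi> \<theta>) = m" by simp
  moreover have "inj_on (\<lambda>i. card (B i)) (top_indices n m \<pi> \<theta>)"
    by (rule inj_on_subset[OF inj]) (auto simp: top)
  ultimately show ?thesis by (simp add: card_image)
qed

text \<open>
  Random tie-breaking: \<open>\<pi>\<close> is a uniformly random permutation of \<open>{1..n}\<close>, independent of
  all of \<open>(\<mu>, \<sigma>, X)\<close>.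
\<close>

definition random_tie_break ::
  "'a measure \<Rightarrow> nat \<Rightarrow> (nat \<Rightarrow> 'a \<Rightarrow> real) \<Rightarrow> (nat \<Rightarrow> 'a \<Rightarrow> real) \<Rightarrow> (nat \<Rightarrow> 'a \<Rightarrow> real) \<Rightarrow>
    ('a \<Rightarrow> nat \<Rightarrow> nat) \<Rightarrow> bool" where
  "random_tie_break M n \<mu> \<sigma> X \<pi> \<longleftrightarrow>
    \<pi> \<in> M \<rightarrow>\<^sub>M count_space UNIV \<and>
    (let D = (\<Pi>\<^sub>M i\<in>{1..n}. borel \<Otimes>\<^sub>M borel \<Otimes>\<^sub>M borel);
         data = (\<lambda>\<omega>. \<lambda>i\<in>{1..n}. (\<mu> i \<omega>, \<sigma> i \<omega>, X i \<omega>))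
     in distr M (count_space UNIV \<Otimes>\<^sub>M D) (\<lambda>\<omega>. (\<pi> \<omega>, data \<omega>)) =
        measure_pmf (pmf_of_set {p. p permutes {1..n}}) \<Otimes>\<^sub>M distr M D data)"

definition regret :: "nat \<Rightarrow> nat set \<Rightarrow> nat set \<Rightarrow> (nat \<Rightarrow> real) \<Rightarrow> real" where
  "regret n J_Bayes J_EB \<theta> =
    1 / real n * (\<Sum>i=1..n. (indicator J_Bayes i - indicator J_EB i) * \<theta> i)"

text \<open>
  Regret of selecting \<open>m\<close> units with the empirical Bayes prior \<open>N(h, 1)\<close> relative to the true
  prior \<open>N(0, 1)\<close>, as a function of the data \<open>(s, x)\<close> and the tie-breaking permutations of
  the two selections.
\<close>

definition selection_regret ::
  "nat \<Rightarrow> nat \<Rightarrow> (nat \<Rightarrow> real) \<Rightarrow> (nat \<Rightarrow> real) \<Rightarrow> real \<Rightarrow> (nat \<Rightarrow> nat) \<Rightarrow> (nat \<Rightarrow> nat) \<Rightarrow> real" where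
  "selection_regret n m s x h \<pi>B \<pi>E =
    (let \<theta> = (\<lambda>i. posterior_mean 0 (s i) (x i));
         \<theta>_hat = (\<lambda>i. posterior_mean h (s i) (x i))
     in regret n (top_indices n m \<pi>B \<theta>) (top_indices n m \<pi>E \<theta>_hat) \<theta>)"

end

theory Submission
  imports Defs "HOL-Real_Asymp.Real_Asymp"
begin

text \<open>
  The maximum likelihood estimator is a weighted mean of the observations, so it is of exact order
  \<open>n\<^sup>-\<^sup>1\<^sup>/\<^sup>2\<close>, and by the central limit theorem it is below \<open>- (10/9) n\<^sup>-\<^sup>1\<^sup>/\<^sup>2\<close> with
  non-vanishing probability. Such an error shifts the scores of the two noise levels against each
  other by the order of \<open>n\<^sup>-\<^sup>1\<^sup>/\<^sup>2\<close>. Since the scores have a positive density, the order of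
  \<open>n\<^sup>1\<^sup>/\<^sup>2\<close> units in a window of width of order \<open>n\<^sup>-\<^sup>1\<^sup>/\<^sup>2\<close> around the selection threshold are
  then misclassified, each at a loss of order \<open>n\<^sup>-\<^sup>1\<^sup>/\<^sup>2\<close>; so the unnormalised regret is bounded
  below by a constant. The threshold is random, but Hoeffding's inequality confines it to
  \<open>O(n\<^sup>-\<^sup>1\<^sup>/\<^sup>2)\<close> around the population quantile, so it suffices to control the counts in a fixed
  number of windows, which follows from a Chernoff bound.
\<close>

subsection \<open>A deterministic lower bound for the regret\<close>

text \<open>The estimator, the Bayes threshold and the window counts are functions of the same
  sample. No conditioning separates them: the failure probabilities are subtracted, by a union
  bound, from the limiting probability that the estimate is far enough below zero. The windows are
  fixed in advance, so the bound covers whichever of them the random threshold picks out.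

  The two concentration steps differ in strength. A count above a fixed point has mean of order n
  and fluctuates by sqrt n, so Hoeffding confines the threshold to distance K / sqrt n with a
  failure bound that depends on K but not on n; hence K is a free constant. A window of width
  n^(-1/2) has a mean count of order sqrt n only, and the Hoeffding bound for a deviation of that
  order does not tend to zero. A multiplicative bound, exponentially small in sqrt n, takes its
  place and vanishes for any fixed number of windows.

  The empirical Bayes threshold is never located. It is only compared with the Bayes threshold, and
  either outcome leaves enough units of one noise level misclassified.\<close>

lemma likelihood_eq_exp:
  "likelihood n s x \<eta> = (\<Prod>i=1..n. 1 / sqrt (2 * pi * (1 + (s i)\<^sup>2))) *
     exp (- (\<Sum>i=1..n. (x i - \<eta>)\<^sup>2 / (1 + (s i)\<^sup>2)) / 2)"
proof -
  have "likelihood n s x \<eta> = (\<Prod>i=1..n. 1 / sqrt (2 * pi * (1 + (s i)\<^sup>2)) *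
      exp (- ((x i - \<eta>)\<^sup>2 / (1 + (s i)\<^sup>2)) / 2))"
    by (simp add: likelihood_def marginal_density_def normal_density_def field_simps)
  also have "\<dots> = (\<Prod>i=1..n. 1 / sqrt (2 * pi * (1 + (s i)\<^sup>2))) *
      (\<Prod>i=1..n. exp (- ((x i - \<eta>)\<^sup>2 / (1 + (s i)\<^sup>2)) / 2))"
    by (rule prod.distrib)
  also have "(\<Prod>i=1..n. exp (- ((x i - \<eta>)\<^sup>2 / (1 + (s i)\<^sup>2)) / 2)) =
      exp (- (\<Sum>i=1..n. (x i - \<eta>)\<^sup>2 / (1 + (s i)\<^sup>2)) / 2)"
    by (simp add: exp_sum[symmetric] sum_negf sum_divide_distrib)
  finally show ?thesis .
qed

text \<open>The log-likelihood is quadratic in \<eta>: the weighted sums of squares at \<eta> and at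
  the weighted mean \<open>a\<close> differ by \<open>W * (\<eta> - a)\<^sup>2\<close> with
  \<open>W > 0\<close>, so \<open>a\<close> is the only maximiser. Each term
  \<open>w i * x i\<close> is an oracle score, which ties the estimator to the sum of the scores
  that define the regret.\<close>

lemma mle_eq_weighted_mean:
  assumes "n \<ge> 1" "is_mle n s x \<eta>"
  shows "\<eta> = (\<Sum>i=1..n. posterior_mean 0 (s i) (x i)) / (\<Sum>i=1..n. 1 / (1 + (s i)\<^sup>2))"
proof -
  define w where "w = (\<lambda>i. 1 / (1 + (s i)\<^sup>2))"
  define W where "W = (\<Sum>i=1..n. w i)"
  define a where "a = (\<Sum>i=1..n. w i * x i) / W"
  have pos: "1 + (s i)\<^sup>2 > 0" for i by (rule add_pos_nonneg) auto
  have "W > 0"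
    unfolding W_def w_def using assms(1) pos by (intro sum_pos) auto
  have "(\<Prod>i=1..n. 1 / sqrt (2 * pi * (1 + (s i)\<^sup>2))) > 0"
    using pos by (intro prod_pos) (auto intro!: mult_pos_pos)
  moreover have "likelihood n s x a \<le> likelihood n s x \<eta>"
    using assms(2) by (auto simp: is_mle_def is_arg_max_def not_less)
  ultimately have le: "(\<Sum>i=1..n. w i * (x i - \<eta>)\<^sup>2) \<le> (\<Sum>i=1..n. w i * (x i - a)\<^sup>2)"
    by (simp add: likelihood_eq_exp w_def)
  have "(\<Sum>i=1..n. w i * x i) = W * a" using \<open>W > 0\<close> by (simp add: a_def)
  then have sq: "(\<Sum>i=1..n. w i * (x i - b)\<^sup>2) =
      (\<Sum>i=1..n. w i * (x i)\<^sup>2) - 2 * b * (W * a) + W * b\<^sup>2" for b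
    by (simp flip: \<open>(\<Sum>i=1..n. w i * x i) = W * a\<close>) (simp add: W_def sum.distrib sum_subtractf sum_distrib_left sum_distrib_right
        power2_diff algebra_simps)
  have "W * (\<eta> - a)\<^sup>2 \<le> 0"
    using le unfolding sq by (simp add: power2_eq_square algebra_simps)
  then have "\<eta> = a"
    using \<open>W > 0\<close> by (simp add: mult_le_0_iff)
  then show ?thesis
    by (simp add: a_def W_def w_def posterior_mean_def add.commute)
qed

text \<open>Since \<open>J\<close> and \<open>K\<close> have equal size, replacing each score by its
  distance to \<open>t\<close> leaves the regret unchanged. After this recentring every summand is
  nonnegative, because \<open>t\<close> separates \<open>J\<close> from its complement, and each
  index of \<open>D\<close> contributes at least \<open>e\<close>.\<close>

lemma regret_ge_gap:
  fixes \<theta> :: "nat \<Rightarrow> real"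
  assumes "n \<ge> 1" "J \<subseteq> {1..n}" "K \<subseteq> {1..n}" "card J = card K"
    and J: "\<And>i. i \<in> J \<Longrightarrow> t \<le> \<theta> i" "\<And>i. i \<in> {1..n} - J \<Longrightarrow> \<theta> i \<le> t"
    and "D \<subseteq> {1..n}" "e \<ge> 0"
    and D: "D \<inter> K = {} \<and> (\<forall>i\<in>D. t + e < \<theta> i) \<or> D \<subseteq> K \<and> (\<forall>i\<in>D. \<theta> i < t - e)"
  shows "e * card D / n \<le> regret n J K \<theta>"
proof -
  let ?d = "\<lambda>i. (indicator J i - indicator K i) * (\<theta> i - t)"
  have fin: "finite J" "finite K" using assms(2,3) by (auto intro: finite_subset)
  have card: "(\<Sum>i=1..n. indicator S i) = real (card S)" if "S \<subseteq> {1..n}" for S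
    using that by (simp add: indicator_def sum.If_cases Int_absorb1)
  have "(\<Sum>i=1..n. (indicator J i - indicator K i) * t) = 0"
    by (simp only: sum_distrib_right[symmetric] sum_subtractf card[OF assms(2)] card[OF assms(3)]
        assms(4) diff_self mult_zero_left)
  then have eq: "regret n J K \<theta> = 1 / n * (\<Sum>i=1..n. ?d i)"
    by (simp add: regret_def right_diff_distrib sum_subtractf)
  have nonneg: "?d i \<ge> 0" if "i \<in> {1..n}" for i
    using J[of i] that by (auto simp: indicator_def)
  have gap: "e \<le> ?d i" if "i \<in> D" for i
  proof -
    have "i \<in> {1..n}" using that \<open>D \<subseteq> {1..n}\<close> by auto
    from D show ?thesis
    proof
      assume *: "D \<inter> K = {} \<and> (\<forall>i\<in>D. t + e < \<theta> i)"
      then have "i \<in> J" using J(2)[of i] \<open>i \<in> {1..n}\<close> that \<open>e \<ge> 0\<close> by force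
      then show ?thesis using * that by (auto simp: indicator_def)
    next
      assume *: "D \<subseteq> K \<and> (\<forall>i\<in>D. \<theta> i < t - e)"
      then have "i \<notin> J" using J(1)[of i] that \<open>e \<ge> 0\<close> by force
      then show ?thesis using * that by (auto simp: indicator_def)
    qed
  qed
  have "e * card D = (\<Sum>i\<in>D. e)" by simp
  also have "\<dots> \<le> (\<Sum>i\<in>D. ?d i)" by (intro sum_mono gap)
  also have "\<dots> \<le> (\<Sum>i=1..n. ?d i)"
    using \<open>D \<subseteq> {1..n}\<close> nonneg by (intro sum_mono2) auto
  finally show ?thesis unfolding eq by (simp add: divide_right_mono)
qed

text \<open>
  Up to a common shift, a negative estimate \<open>h\<close> raises the scores of the units with \<open>\<sigma>\<^sub>i = 1\<close>
  by \<open>\<delta> = - 3/10 h\<close>. If the empirical Bayes threshold exceeds the Bayes threshold \<open>t\<close> by at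
  least \<open>\<delta>/2\<close>, the units with \<open>\<sigma>\<^sub>i = 2\<close> slightly above \<open>t\<close> are lost; otherwise the units with
  \<open>\<sigma>\<^sub>i = 1\<close> slightly below \<open>t\<close> are wrongly selected.
\<close>

lemma selection_regret_ge:
  fixes s x :: "nat \<Rightarrow> real"
  defines "\<theta> \<equiv> \<lambda>i. posterior_mean 0 (s i) (x i)"
  assumes m: "1 \<le> m" "m \<le> n"
    and inj: "inj_on \<pi>B {1..n}" "inj_on \<pi>E {1..n}"
    and s: "\<And>i. i \<in> {1..n} \<Longrightarrow> s i \<in> {1, 2}"
    and d: "d > 0" "h \<le> - 10 / 3 * d"
    and b: "card {i \<in> {1..n}. b < \<theta> i} < m"
    and a: "m \<le> card {i \<in> {1..n}. a < \<theta> i}"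
    and N: "\<And>r y. r \<in> {1, 2} \<Longrightarrow> a - d / 2 \<le> y \<Longrightarrow> y \<le> b + d / 4 \<Longrightarrow>
          N \<le> real (card {i \<in> {1..n}. s i = r \<and> \<theta> i \<in> {y<..<y + d / 4}})"
  shows "d * N / 4 / n \<le> selection_regret n m s x h \<pi>B \<pi>E"
proof -
  define \<psi> where "\<psi> = (\<lambda>i. posterior_mean h (s i) (x i))"
  define J where "J = top_indices n m \<pi>B \<theta>"
  define K where "K = top_indices n m \<pi>E \<psi>"
  define t where "t = Min (\<theta> ` J)"
  \<comment> \<open>The prior mean has weight 1/2 in the posterior mean for noise level 1 and 4/5
    for noise level 2. Removing the common shift \<open>4 / 5 * h\<close> puts the empirical Bayes
    threshold on the scale of the oracle scores; what remains is the shift by \<delta>, with 3/10 =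
    4/5 - 1/2, of the units with noise level 1.\<close>
  define u where "u = Min (\<psi> ` K) - 4 / 5 * h"
  define \<delta> where "\<delta> = - (3 / 10) * h"
  have "\<delta> \<ge> d" using d(2) by (simp add: \<delta>_def)
  have JK: "J \<subseteq> {1..n}" "K \<subseteq> {1..n}"
    by (auto simp: J_def K_def top_indices_def)
  have card: "card J = m" "card K = m"
    using inj m by (simp_all add: J_def K_def card_top_indices)
  have fin: "finite J" "finite K" using JK by (auto intro: finite_subset)
  have ne: "J \<noteq> {}" "K \<noteq> {}" using card m by auto
  have J1: "t \<le> \<theta> i" if "i \<in> J" for i
    using that fin by (auto simp: t_def)
  have J2: "\<theta> i \<le> t" if "i \<in> {1..n} - J" for i
    unfolding t_def using fin ne that
    by (auto simp: J_def intro!: top_indices_larger[of _ n m \<pi>B \<theta> i])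
  have K1: "u + 4 / 5 * h \<le> \<psi> i" if "i \<in> K" for i
    using that fin by (auto simp: u_def)
  have K2: "\<psi> i \<le> u + 4 / 5 * h" if "i \<in> {1..n} - K" for i
    unfolding u_def using fin ne that
    by (auto simp: K_def intro!: top_indices_larger[of _ n m \<pi>E \<psi> i])
  have \<psi>: "\<psi> i = \<theta> i + 4 / 5 * h + (if s i = 1 then \<delta> else 0)" if "i \<in> {1..n}" for i
    using s[OF that] by (auto simp: \<psi>_def \<theta>_def posterior_mean_def \<delta>_def)
  have "t \<le> b"
  proof (rule ccontr)
    assume "\<not> t \<le> b"
    then have "J \<subseteq> {i \<in> {1..n}. b < \<theta> i}" using J1 JK by force
    then have "card J \<le> card {i \<in> {1..n}. b < \<theta> i}" by (intro card_mono) auto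
    then show False using b card by simp
  qed
  have "a \<le> t"
  proof (rule ccontr)
    assume "\<not> a \<le> t"
    moreover have "t \<in> \<theta> ` J" unfolding t_def using fin ne by (intro Min_in) auto
    ultimately have "{i \<in> {1..n}. a < \<theta> i} \<subset> J" using J2 by force
    then have "card {i \<in> {1..n}. a < \<theta> i} < card J" by (intro psubset_card_mono fin)
    then show False using a card by simp
  qed
  have main: "d / 4 * card D / n \<le> regret n J K \<theta>"
    if "D \<subseteq> {1..n}"
      "D \<inter> K = {} \<and> (\<forall>i\<in>D. t + d / 4 < \<theta> i) \<or> D \<subseteq> K \<and> (\<forall>i\<in>D. \<theta> i < t - d / 4)" for D
    using that JK J1 J2 card d m by (intro regret_ge_gap[of n J K t \<theta> D "d / 4"]) auto
  have "d / 4 * N / n \<le> regret n J K \<theta>"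
  proof (cases "u \<ge> t + \<delta> / 2")
    case True
    \<comment> \<open>These units satisfy \<theta> < t + d/2 \<le> t + \<delta>/2 \<le> u, so they
      miss the empirical threshold, yet they exceed the Bayes threshold by more than d/4.\<close>
    define D where "D = {i \<in> {1..n}. s i = 2 \<and> \<theta> i \<in> {t + d / 4<..<t + d / 4 + d / 4}}"
    have "D \<inter> K = {}"
      using K1 \<psi> True \<open>\<delta> \<ge> d\<close> by (fastforce simp: D_def)
    then have "d / 4 * card D / n \<le> regret n J K \<theta>"
      by (intro main) (auto simp: D_def)
    moreover have "N \<le> card D"
      unfolding D_def using \<open>a \<le> t\<close> \<open>t \<le> b\<close> d by (intro N) auto
    then have "d / 4 * N / n \<le> d / 4 * card D / n"
      using d by (intro divide_right_mono mult_left_mono) auto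
    ultimately show ?thesis by simp
  next
    case False
    \<comment> \<open>Here \<theta> + \<delta> > t - d/2 + \<delta> \<ge> t + \<delta>/2 > u, so the
      shift lifts these units above the empirical threshold although they lie more than d/4 below
      the Bayes threshold.\<close>
    define D where "D = {i \<in> {1..n}. s i = 1 \<and> \<theta> i \<in> {t - d / 2<..<t - d / 2 + d / 4}}"
    have "i \<in> K" if "i \<in> D" for i
    proof (rule ccontr)
      assume "i \<notin> K"
      then show False
        using K2[of i] \<psi>[of i] False \<open>\<delta> \<ge> d\<close> that by (auto simp: D_def)
    qed
    then have "d / 4 * card D / n \<le> regret n J K \<theta>"
      by (intro main) (auto simp: D_def)
    moreover have "N \<le> card D"
      unfolding D_def using \<open>a \<le> t\<close> \<open>t \<le> b\<close> d by (intro N) auto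
    then have "d / 4 * N / n \<le> d / 4 * card D / n"
      using d by (intro divide_right_mono mult_left_mono) auto
    ultimately show ?thesis by simp
  qed
  then show ?thesis
    by (simp add: selection_regret_def J_def K_def \<theta>_def \<psi>_def Let_def)
qed

section \<open>Measurability of the regret and the tie-breaking orders\<close>

lemma measurable_top_indices [measurable]:
  assumes [measurable]: "\<pi> \<in> M \<rightarrow>\<^sub>M count_space UNIV"
    "\<And>j. j \<in> {1..n} \<Longrightarrow> f j \<in> borel_measurable M"
  shows "Measurable.pred M (\<lambda>\<omega>. i \<in> top_indices n m (\<pi> \<omega>) (\<lambda>j. f j \<omega> :: real))"
proof (cases "i \<in> {1..n}")
  case True
  have \<pi>: "Measurable.pred M (\<lambda>\<omega>. \<pi> \<omega> j < \<pi> \<omega> i)" for j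
    by (rule measurable_compose[OF assms(1)]) simp
  have *: "Measurable.pred M (\<lambda>\<omega>. f i \<omega> < f j \<omega> \<or> f i \<omega> = f j \<omega> \<and> \<pi> \<omega> j < \<pi> \<omega> i)"
    if [measurable]: "j \<in> {1..n}" for j
    using True \<pi> by measurable
  have "i \<in> top_indices n m (\<pi> \<omega>) (\<lambda>j. f j \<omega>) \<longleftrightarrow>
      (\<Sum>j\<in>{1..n}. if f i \<omega> < f j \<omega> \<or> f i \<omega> = f j \<omega> \<and> \<pi> \<omega> j < \<pi> \<omega> i then 1 else 0) < m" for \<omega>
    using True by (simp add: top_indices_def sum.If_cases Int_def)
  moreover have "Measurable.pred M (\<lambda>\<omega>.
      (\<Sum>j\<in>{1..n}. if f i \<omega> < f j \<omega> \<or> f i \<omega> = f j \<omega> \<and> \<pi> \<omega> j < \<pi> \<omega> i then 1 else 0) < m)"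
    using * by (intro measurable_compose[OF measurable_sum_nat, of _ _ _ "\<lambda>k. k < m"] measurable_If) auto
  ultimately show ?thesis by (simp only:)
next
  case False
  then have "i \<notin> top_indices n m (\<pi> \<omega>) (\<lambda>j. f j \<omega>)" for \<omega>
    unfolding top_indices_def by blast
  then show ?thesis by (simp only:) simp
qed

lemma measurable_selection_regret:
  assumes [measurable]: "\<And>i. i \<in> {1..n} \<Longrightarrow> s i \<in> borel_measurable M"
    "\<And>i. i \<in> {1..n} \<Longrightarrow> x i \<in> borel_measurable M" "h \<in> borel_measurable M"
    "\<pi>B \<in> M \<rightarrow>\<^sub>M count_space UNIV" "\<pi>E \<in> M \<rightarrow>\<^sub>M count_space UNIV"
  shows "(\<lambda>\<omega>. selection_regret n m (\<lambda>i. s i \<omega>) (\<lambda>i. x i \<omega>) (h \<omega>) (\<pi>B \<omega>) (\<pi>E \<omega>)) \<in> borel_measurable M"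
proof -
  have [measurable]: "(\<lambda>\<omega>. posterior_mean (g \<omega>) (s i \<omega>) (x i \<omega>)) \<in> borel_measurable M"
    if "g \<in> borel_measurable M" and [measurable]: "i \<in> {1..n}" for g i
    unfolding posterior_mean_def using that by measurable
  have [measurable]: "(\<lambda>\<omega>. indicator (top_indices n m (\<pi> \<omega>)
        (\<lambda>j. posterior_mean (g \<omega>) (s j \<omega>) (x j \<omega>))) i :: real) \<in> borel_measurable M"
    if [measurable]: "\<pi> \<in> M \<rightarrow>\<^sub>M count_space UNIV" "g \<in> borel_measurable M" for \<pi> g i
    unfolding indicator_def by measurable
  show ?thesis
    unfolding selection_regret_def regret_def Let_def by measurable
qed

text \<open>The first marginal of the joint law is uniform on permutations, so the rectangle
  \<open>S \<times> space D\<close> has full measure. Injectivity of the order is what gives both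
  selections exactly \<open>m\<close> elements.\<close>

lemma (in prob_space) random_tie_break_permutes:
  assumes rtb: "random_tie_break M n \<mu> \<sigma> X \<pi>"
    and [measurable]: "\<And>i. i \<in> {1..n} \<Longrightarrow> \<mu> i \<in> borel_measurable M"
      "\<And>i. i \<in> {1..n} \<Longrightarrow> \<sigma> i \<in> borel_measurable M" "\<And>i. i \<in> {1..n} \<Longrightarrow> X i \<in> borel_measurable M"
  shows "AE \<omega> in M. \<pi> \<omega> permutes {1..n}"
proof -
  define D where "D = (\<Pi>\<^sub>M i\<in>{1..n}. borel \<Otimes>\<^sub>M borel \<Otimes>\<^sub>M (borel :: real measure) :: (real \<times> real \<times> real) measure)"
  define data where "data = (\<lambda>\<omega>. \<lambda>i\<in>{1..n}. (\<mu> i \<omega>, \<sigma> i \<omega>, X i \<omega>))"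
  define S where "S = {p. p permutes {1..n}}"
  define P where "P = pmf_of_set S"
  have [measurable]: "\<pi> \<in> M \<rightarrow>\<^sub>M count_space UNIV"
    and eq: "distr M (count_space UNIV \<Otimes>\<^sub>M D) (\<lambda>\<omega>. (\<pi> \<omega>, data \<omega>)) = measure_pmf P \<Otimes>\<^sub>M distr M D data"
    using rtb unfolding random_tie_break_def Let_def D_def data_def P_def S_def by auto
  have [measurable]: "data \<in> M \<rightarrow>\<^sub>M D"
    unfolding data_def D_def by measurable
  interpret data: prob_space "distr M D data" by (rule prob_space_distr) simp
  have S: "finite S" "S \<noteq> {}"
    unfolding S_def using finite_permutations[of "{1..n}"] permutes_id[of "{1..n}"] by blast+
  then have "emeasure (measure_pmf P) S = 1"
    by (intro measure_pmf.emeasure_eq_1_AE) (auto simp: P_def AE_measure_pmf_iff)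
  moreover have "emeasure (distr M D data) (space D) = 1"
    using data.emeasure_space_1 by simp
  ultimately have "emeasure (measure_pmf P \<Otimes>\<^sub>M distr M D data) (S \<times> space D) = 1"
    by (subst data.emeasure_pair_measure_Times) auto
  then have "emeasure M ((\<lambda>\<omega>. (\<pi> \<omega>, data \<omega>)) -` (S \<times> space D) \<inter> space M) = 1"
    unfolding eq[symmetric] by (subst (asm) emeasure_distr) auto
  then have "AE \<omega> in M. \<omega> \<in> (\<lambda>\<omega>. (\<pi> \<omega>, data \<omega>)) -` (S \<times> space D) \<inter> space M"
    by (intro AE_prob_1) (simp add: measure_def)
  then show ?thesis by (auto simp: S_def elim: AE_mp)
qed

subsection \<open>The joint law of noise levels and scores\<close>

lemma measurable_normal_density [measurable (raw)]:
  assumes [measurable]: "f \<in> borel_measurable M" "g \<in> borel_measurable M" "h \<in> borel_measurable M"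
  shows "(\<lambda>x. normal_density (f x) (g x) (h x)) \<in> borel_measurable M"
  unfolding normal_density_def by measurable

lemma measurable_emeasure_normal [measurable]:
  assumes [measurable]: "A \<in> sets borel"
  shows "(\<lambda>m. emeasure (density lborel (normal_density m r)) A) \<in> borel_measurable borel"
proof -
  have "emeasure (density lborel (normal_density m r)) A =
      (\<integral>\<^sup>+ x. ennreal (normal_density m r x) * indicator A x \<partial>lborel)" for m
    by (rule emeasure_density) auto
  then show ?thesis by simp
qed

text \<open>After exchanging the integrals, Bayes' rule turns prior times likelihood into marginal
  times posterior, and the posterior density integrates to one.\<close>

lemma nn_integral_emeasure_normal:
  assumes [measurable]: "A \<in> sets borel" and "r > 0"
  shows "(\<integral>\<^sup>+ m. emeasure (density lborel (normal_density m r)) A \<partial>density lborel std_normal_density) =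
    emeasure (density lborel (normal_density 0 (sqrt (1 + r\<^sup>2)))) A"
proof -
  let ?q = "\<lambda>x. normal_density (posterior_mean 0 r x) (r / sqrt (1 + r\<^sup>2))"
  have [measurable]: "posterior_mean 0 r \<in> borel_measurable borel"
    unfolding posterior_mean_def by measurable
  have "1 + r\<^sup>2 > 0" by (rule add_pos_nonneg) auto
  then have post: "(\<integral>\<^sup>+ m. ennreal (?q x m) \<partial>lborel) = 1" for x
    using \<open>r > 0\<close> by (subst nn_integral_eq_integral) auto
  have "(\<integral>\<^sup>+ m. emeasure (density lborel (normal_density m r)) A \<partial>density lborel std_normal_density) =
      (\<integral>\<^sup>+ m. \<integral>\<^sup>+ x. ennreal (std_normal_density m * normal_density m r x) * indicator A x \<partial>lborel \<partial>lborel)"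
    by (simp add: nn_integral_density emeasure_density nn_integral_cmult[symmetric] ennreal_mult mult.assoc)
  also have "\<dots> = (\<integral>\<^sup>+ x. \<integral>\<^sup>+ m. ennreal (std_normal_density m * normal_density m r x) * indicator A x \<partial>lborel \<partial>lborel)"
    by (rule lborel_pair.Fubini') measurable
  also have "\<dots> = (\<integral>\<^sup>+ x. \<integral>\<^sup>+ m. ennreal (normal_density 0 (sqrt (1 + r\<^sup>2)) x) * indicator A x *
      ennreal (?q x m) \<partial>lborel \<partial>lborel)"
    using bayes_rule_normal[OF \<open>r > 0\<close>, of 0]
    by (simp add: marginal_density_def ennreal_mult mult_ac)
  also have "\<dots> = (\<integral>\<^sup>+ x. ennreal (normal_density 0 (sqrt (1 + r\<^sup>2)) x) * indicator A x \<partial>lborel)"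
    by (simp add: nn_integral_cmult post)
  also have "\<dots> = emeasure (density lborel (normal_density 0 (sqrt (1 + r\<^sup>2)))) A"
    by (simp add: emeasure_density)
  finally show ?thesis .
qed

definition oracle_score :: "(nat \<Rightarrow> 'a \<Rightarrow> real) \<Rightarrow> (nat \<Rightarrow> 'a \<Rightarrow> real) \<Rightarrow> nat \<Rightarrow> 'a \<Rightarrow> real" where
  "oracle_score \<sigma> X i \<omega> = posterior_mean 0 (\<sigma> i \<omega>) (X i \<omega>)"

text \<open>The law of the oracle score given noise level \<open>r\<close>: the observation is
  centred normal with variance 1 + r^2 and the score divides it by 1 + r^2, which leaves variance 1
  / (1 + r^2).\<close>

definition score_law :: "real \<Rightarrow> real measure" where
  "score_law r = density lborel (normal_density 0 (1 / sqrt (1 + r\<^sup>2)))"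

context normal_means_model
begin

abbreviation \<theta> :: "nat \<Rightarrow> 'a \<Rightarrow> real" where
  "\<theta> \<equiv> oracle_score \<sigma> X"

lemma measurable_params [measurable]:
  shows measurable_\<mu>: "i \<in> {1..n} \<Longrightarrow> \<mu> i \<in> borel_measurable M"
    and measurable_\<sigma>: "i \<in> {1..n} \<Longrightarrow> \<sigma> i \<in> borel_measurable M"
  using indep_\<mu> indep_\<sigma> by (auto simp: indep_vars_def2)

lemma AE_\<sigma>: "AE \<omega> in M. \<forall>i\<in>{1..n}. \<sigma> i \<omega> \<in> {1, 2}"
proof (rule AE_finite_allI)
  fix i assume [measurable]: "i \<in> {1..n}"
  have "prob {\<omega> \<in> space M. \<sigma> i \<omega> \<in> {1, 2}} =
      prob ({\<omega> \<in> space M. \<sigma> i \<omega> = 1} \<union> {\<omega> \<in> space M. \<sigma> i \<omega> = 2})"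
    by (rule arg_cong[of _ _ prob]) auto
  also have "\<dots> = prob {\<omega> \<in> space M. \<sigma> i \<omega> = 1} + prob {\<omega> \<in> space M. \<sigma> i \<omega> = 2}"
    by (rule finite_measure_Union) auto
  also have "\<dots> = 1" using distr_\<sigma>[OF \<open>i \<in> {1..n}\<close>] by simp
  finally have "AE \<omega> in M. \<omega> \<in> {\<omega> \<in> space M. \<sigma> i \<omega> \<in> {1, 2}}" by (rule AE_prob_1)
  then show "AE \<omega> in M. \<sigma> i \<omega> \<in> {1, 2}" by (auto elim: AE_mp)
qed simp

text \<open>By independence the joint law of the two parameter vectors is a product of product
  measures, so the integral factorises over the coordinates. The means are integrated against their
  density, while the noise levels stay inside an expectation because they are known only through two
  point probabilities.\<close>

lemma nn_integral_params_prod: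
  fixes g :: "nat \<Rightarrow> real \<Rightarrow> real \<Rightarrow> ennreal"
  assumes [measurable]: "\<And>i. i \<in> {1..n} \<Longrightarrow> (\<lambda>(m, s). g i m s) \<in> borel_measurable (borel \<Otimes>\<^sub>M borel)"
  shows "(\<integral>\<^sup>+ \<omega>. (\<Prod>i=1..n. g i (\<mu> i \<omega>) (\<sigma> i \<omega>)) \<partial>M) =
    (\<Prod>i=1..n. \<integral>\<^sup>+ \<omega>. (\<integral>\<^sup>+ m. g i m (\<sigma> i \<omega>) \<partial>density lborel std_normal_density) \<partial>M)"
proof (cases "n = 0")
  case True
  then show ?thesis by (simp add: emeasure_space_1)
next
  case False
  define I where "I = {1..n}"
  define N where "N = density lborel std_normal_density"
  \<comment> \<open>Coordinates outside \<open>I\<close> get the default law \<open>N\<close>: the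
    product construction asks for a sigma-finite measure at every index, while nothing is known
    about \<open>\<sigma> i\<close> there.\<close>
  define S where "S = (\<lambda>i. if i \<in> I then distr M borel (\<sigma> i) else N)"
  have I: "finite I" "I \<noteq> {}" using False by (auto simp: I_def)
  have [measurable]: "i \<in> I \<Longrightarrow> \<mu> i \<in> borel_measurable M" "i \<in> I \<Longrightarrow> \<sigma> i \<in> borel_measurable M"
    "i \<in> I \<Longrightarrow> (\<lambda>(m, s). g i m s) \<in> borel_measurable (borel \<Otimes>\<^sub>M borel)" for i
    using assms by (auto simp: I_def)
  interpret N: prob_space N
    unfolding N_def by (rule prob_space_normal_density) simp
  have prob_S: "prob_space (S i)" for i
    by (auto simp: S_def N.prob_space_axioms intro!: prob_space_distr)
  interpret S: prob_space "S i" for i by (rule prob_S)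
  interpret PN: product_sigma_finite "\<lambda>_. N" ..
  interpret PS: product_sigma_finite S ..
  have sets_S [measurable_cong]: "sets (S i) = sets borel" for i
    by (simp add: S_def N_def)
  have sets_N [measurable_cong]: "sets N = sets borel" by (simp add: N_def)
  have sets_PN [measurable_cong]: "sets (Pi\<^sub>M I (\<lambda>_. N)) = sets (Pi\<^sub>M I (\<lambda>_. borel))"
    by (intro sets_PiM_cong) (auto simp: sets_N)
  have sets_PS [measurable_cong]: "sets (Pi\<^sub>M I S) = sets (Pi\<^sub>M I (\<lambda>_. borel))"
    by (intro sets_PiM_cong) (auto simp: sets_S)
  interpret PS': prob_space "Pi\<^sub>M I S" by (rule prob_space_PiM) (rule prob_S)
  interpret PN': prob_space "Pi\<^sub>M I (\<lambda>_. N)" by (rule prob_space_PiM) (rule N.prob_space_axioms)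
  interpret P: pair_sigma_finite "Pi\<^sub>M I (\<lambda>_. N)" "Pi\<^sub>M I S" ..
  let ?\<mu> = "\<lambda>\<omega>. \<lambda>i\<in>I. \<mu> i \<omega>" and ?\<sigma> = "\<lambda>\<omega>. \<lambda>i\<in>I. \<sigma> i \<omega>"
  have "distr M (Pi\<^sub>M I (\<lambda>_. borel)) ?\<mu> = Pi\<^sub>M I (\<lambda>i. distr M borel (\<mu> i))"
    using indep_\<mu> I by (subst indep_vars_iff_distr_eq_PiM'[symmetric]) (auto simp: I_def)
  also have "\<dots> = Pi\<^sub>M I (\<lambda>_. N)"
  proof (intro PiM_cong refl)
    fix i assume "i \<in> I"
    have "distr M borel (\<mu> i) = distr M lborel (\<mu> i)" by (rule distr_cong) auto
    then show "distr M borel (\<mu> i) = N"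
      using distr_\<mu>[of i] \<open>i \<in> I\<close> by (simp add: N_def I_def distributed_distr_eq_density)
  qed
  finally have \<mu>: "distr M (Pi\<^sub>M I (\<lambda>_. borel)) ?\<mu> = Pi\<^sub>M I (\<lambda>_. N)" .
  have "distr M (Pi\<^sub>M I (\<lambda>_. borel)) ?\<sigma> = Pi\<^sub>M I (\<lambda>i. distr M borel (\<sigma> i))"
    using indep_\<sigma> I by (subst indep_vars_iff_distr_eq_PiM'[symmetric]) (auto simp: I_def)
  also have "\<dots> = Pi\<^sub>M I S"
    by (intro PiM_cong) (auto simp: S_def)
  finally have \<sigma>: "distr M (Pi\<^sub>M I (\<lambda>_. borel)) ?\<sigma> = Pi\<^sub>M I S" .
  have joint: "distr M (Pi\<^sub>M I (\<lambda>_. borel) \<Otimes>\<^sub>M Pi\<^sub>M I (\<lambda>_. borel)) (\<lambda>\<omega>. (?\<mu> \<omega>, ?\<sigma> \<omega>)) =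
      Pi\<^sub>M I (\<lambda>_. N) \<Otimes>\<^sub>M Pi\<^sub>M I S"
    using indep_\<mu>_\<sigma> \<mu> \<sigma> unfolding indep_var_distribution_eq I_def by simp
  have "(\<integral>\<^sup>+ \<omega>. (\<Prod>i\<in>I. g i (\<mu> i \<omega>) (\<sigma> i \<omega>)) \<partial>M) =
      (\<integral>\<^sup>+ p. (\<Prod>i\<in>I. g i (fst p i) (snd p i)) \<partial>distr M (Pi\<^sub>M I (\<lambda>_. borel) \<Otimes>\<^sub>M Pi\<^sub>M I (\<lambda>_. borel)) (\<lambda>\<omega>. (?\<mu> \<omega>, ?\<sigma> \<omega>)))"
    by (subst nn_integral_distr) (auto intro!: nn_integral_cong)
  also have "\<dots> = (\<integral>\<^sup>+ p. (\<Prod>i\<in>I. g i (fst p i) (snd p i)) \<partial>(Pi\<^sub>M I (\<lambda>_. N) \<Otimes>\<^sub>M Pi\<^sub>M I S))"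
    unfolding joint ..
  also have "\<dots> = (\<integral>\<^sup>+ s. (\<integral>\<^sup>+ m. (\<Prod>i\<in>I. g i (m i) (s i)) \<partial>Pi\<^sub>M I (\<lambda>_. N)) \<partial>Pi\<^sub>M I S)"
    by (subst P.nn_integral_snd[symmetric]) auto
  also have "\<dots> = (\<integral>\<^sup>+ s. (\<Prod>i\<in>I. \<integral>\<^sup>+ m. g i m (s i) \<partial>N) \<partial>Pi\<^sub>M I S)"
    by (intro nn_integral_cong PN.product_nn_integral_prod I) (auto simp: space_PiM)
  also have "\<dots> = (\<Prod>i\<in>I. \<integral>\<^sup>+ s. (\<integral>\<^sup>+ m. g i m s \<partial>N) \<partial>S i)"
    by (intro PS.product_nn_integral_prod I) auto
  also have "\<dots> = (\<Prod>i\<in>I. \<integral>\<^sup>+ \<omega>. (\<integral>\<^sup>+ m. g i m (\<sigma> i \<omega>) \<partial>N) \<partial>M)"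
    by (intro prod.cong refl) (simp add: S_def nn_integral_distr)
  finally show ?thesis unfolding I_def N_def .
qed

text \<open>The event about the noise levels belongs to the sigma-algebra generated by the
  parameters, so over it the indicator of the event about \<open>X\<close> may be replaced by its
  conditional probability. That is a product of normal probabilities; integrating out the means and
  averaging over the two noise levels gives the factors.\<close>

lemma emeasure_\<sigma>_X:
  assumes [measurable]: "\<And>i. i \<in> {1..n} \<Longrightarrow> B i \<in> sets borel" "\<And>i. i \<in> {1..n} \<Longrightarrow> A i \<in> sets borel"
  shows "emeasure M {\<omega> \<in> space M. \<forall>i\<in>{1..n}. \<sigma> i \<omega> \<in> B i \<and> X i \<omega> \<in> A i} =
    (\<Prod>i=1..n. \<Sum>r\<in>{1, 2}. ennreal (1 / 2) * (indicator (B i) r *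
       emeasure (density lborel (normal_density 0 (sqrt (1 + r\<^sup>2)))) (A i)))"
proof -
  define P where "P = (\<Pi>\<^sub>M i\<in>{1..n}. borel \<Otimes>\<^sub>M borel :: (real \<times> real) measure)"
  define F where "F = vimage_algebra (space M) (params n \<mu> \<sigma>) P"
  define G where "G = {\<omega> \<in> space M. \<forall>i\<in>{1..n}. \<sigma> i \<omega> \<in> B i}"
  define E where "E = {\<omega> \<in> space M. \<forall>i\<in>{1..n}. X i \<omega> \<in> A i}"
  \<comment> \<open>The kernel is written as a sum over the two noise levels, with which it agrees
    almost surely. Measurability in the mean is then needed for fixed \<open>r\<close> only, and the
    mean can be integrated out term by term.\<close>
  define g where "g = (\<lambda>i m s. \<Sum>r\<in>{1, 2}. indicator {r} s *
    (indicator (B i) r * emeasure (density lborel (normal_density m r)) (A i)))"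
  define k where "k = (\<lambda>i \<omega>. measure (density lborel (normal_density (\<mu> i \<omega>) (\<sigma> i \<omega>))) (A i))"
  have [measurable]: "i \<in> {1..n} \<Longrightarrow> X i \<in> borel_measurable M" for i by (rule measurable_X)
  have [measurable]: "params n \<mu> \<sigma> \<in> M \<rightarrow>\<^sub>M P"
    unfolding params_def P_def by measurable
  have sub: "subalgebra M F"
    unfolding subalgebra_def F_def
    using sets_image_in_sets[OF refl \<open>params n \<mu> \<sigma> \<in> M \<rightarrow>\<^sub>M P\<close>] by simp
  interpret F: finite_measure_subalgebra M F
    by unfold_locales (rule sub)
  have [measurable]: "E \<in> sets M" unfolding E_def by measurable
  have "G = params n \<mu> \<sigma> -` {p \<in> space P. \<forall>i\<in>{1..n}. snd (p i) \<in> B i} \<inter> space M"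
  proof (intro set_eqI)
    fix \<omega>
    have "snd (params n \<mu> \<sigma> \<omega> i) = \<sigma> i \<omega>" if "i \<in> {1..n}" for i
      using that by (simp add: params_def)
    then show "\<omega> \<in> G \<longleftrightarrow> \<omega> \<in> params n \<mu> \<sigma> -` {p \<in> space P. \<forall>i\<in>{1..n}. snd (p i) \<in> B i} \<inter> space M"
      using measurable_space[OF \<open>params n \<mu> \<sigma> \<in> M \<rightarrow>\<^sub>M P\<close>, of \<omega>]
      unfolding G_def by auto
  qed
  moreover have "{p \<in> space P. \<forall>i\<in>{1..n}. snd (p i) \<in> B i} \<in> sets P"
    unfolding P_def by measurable
  ultimately have GF: "G \<in> sets F"
    unfolding F_def by (simp only: in_vimage_algebra)
  then have [measurable]: "G \<in> sets M" using sub by (auto simp: subalgebra_def)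
  have int: "integrable M (indicat_real E)"
    by (rule integrable_const_bound[where B = 1]) auto
  have AE_k: "AE \<omega> in M. real_cond_exp M F (indicator E) \<omega> = (\<Prod>i=1..n. k i \<omega>)"
    unfolding E_def F_def P_def k_def by (rule cond_law_X) (rule assms(2))
  have AE_g: "AE \<omega> in M. ennreal (indicator G \<omega> * real_cond_exp M F (indicator E) \<omega>) = (\<Prod>i=1..n. g i (\<mu> i \<omega>) (\<sigma> i \<omega>))"
    using AE_k AE_\<sigma> AE_space
  proof eventually_elim
    case (elim \<omega>)
    have "g i (\<mu> i \<omega>) (\<sigma> i \<omega>) = ennreal (indicator (B i) (\<sigma> i \<omega>) * k i \<omega>)" if "i \<in> {1..n}" for i
    proof -
      have "\<sigma> i \<omega> > 0" using elim that by force
      then interpret N: prob_space "density lborel (normal_density (\<mu> i \<omega>) (\<sigma> i \<omega>))"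
        by (rule prob_space_normal_density)
      have "ennreal (k i \<omega>) = emeasure (density lborel (normal_density (\<mu> i \<omega>) (\<sigma> i \<omega>))) (A i)"
        by (simp add: k_def N.emeasure_eq_measure)
      then show ?thesis
        using elim that by (auto simp: g_def indicator_def)
    qed
    then have "(\<Prod>i=1..n. g i (\<mu> i \<omega>) (\<sigma> i \<omega>)) = (\<Prod>i=1..n. ennreal (indicator (B i) (\<sigma> i \<omega>) * k i \<omega>))"
      by (intro prod.cong) auto
    also have "\<dots> = ennreal (\<Prod>i=1..n. indicator (B i) (\<sigma> i \<omega>) * k i \<omega>)"
      by (rule prod_ennreal) (simp add: k_def)
    also have "(\<Prod>i=1..n. indicator (B i) (\<sigma> i \<omega>) * k i \<omega>) = (\<Prod>i=1..n. indicator (B i) (\<sigma> i \<omega>)) * (\<Prod>i=1..n. k i \<omega>)"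
      by (rule prod.distrib)
    also have "(\<Prod>i=1..n. indicator (B i) (\<sigma> i \<omega>)) = indicat_real G \<omega>"
      using elim by (auto simp: G_def indicator_def prod_zero_iff intro!: prod.neutral)
    finally show ?case using elim by simp
  qed
  have "AE \<omega> in M. 0 \<le> indicator G \<omega> * real_cond_exp M F (indicator E) \<omega>"
    using AE_k by eventually_elim (auto simp: k_def intro!: mult_nonneg_nonneg prod_nonneg)
  have "measure M (G \<inter> E) = (\<integral>\<omega>. indicator G \<omega> * indicator E \<omega> \<partial>M)"
    by (simp add: indicator_inter_arith[symmetric])
  also have "\<dots> = (\<integral>\<omega>. indicator G \<omega> * real_cond_exp M F (indicator E) \<omega> \<partial>M)"
    using F.real_cond_exp_intA[OF int GF] by (simp add: set_lebesgue_integral_def)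
  finally have "emeasure M (G \<inter> E) = ennreal (\<integral>\<omega>. indicator G \<omega> * real_cond_exp M F (indicator E) \<omega> \<partial>M)"
    by (simp add: emeasure_eq_measure)
  also have "\<dots> = (\<integral>\<^sup>+\<omega>. ennreal (indicator G \<omega> * real_cond_exp M F (indicator E) \<omega>) \<partial>M)"
    using F.real_cond_exp_int(1)[OF int] \<open>AE \<omega> in M. 0 \<le> _\<close>
    by (subst nn_integral_eq_integral) (auto intro!: integrable_real_mult_indicator simp: mult.commute[of "indicator G _"])
  also have "\<dots> = (\<integral>\<^sup>+\<omega>. (\<Prod>i=1..n. g i (\<mu> i \<omega>) (\<sigma> i \<omega>)) \<partial>M)"
    using AE_g by (rule nn_integral_cong_AE)
  also have "\<dots> = (\<Prod>i=1..n. \<integral>\<^sup>+ \<omega>. (\<integral>\<^sup>+ m. g i m (\<sigma> i \<omega>) \<partial>density lborel std_normal_density) \<partial>M)"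
  proof (rule nn_integral_params_prod)
    fix i assume [measurable]: "i \<in> {1..n}"
    have [measurable]: "(\<lambda>p. emeasure (density lborel (normal_density (fst p) r)) (A i)) \<in> borel_measurable (borel \<Otimes>\<^sub>M borel)" for r
      by (rule measurable_compose[OF measurable_fst measurable_emeasure_normal]) measurable
    show "(\<lambda>(m, s). g i m s) \<in> borel_measurable (borel \<Otimes>\<^sub>M borel)"
      unfolding g_def case_prod_beta by measurable
  qed
  also have "\<dots> = (\<Prod>i=1..n. \<Sum>r\<in>{1, 2}. ennreal (1 / 2) * (indicator (B i) r *
       emeasure (density lborel (normal_density 0 (sqrt (1 + r\<^sup>2)))) (A i)))"
  proof (intro prod.cong refl)
    fix i assume i [measurable]: "i \<in> {1..n}"
    define L where "L = (\<lambda>r. indicator (B i) r * emeasure (density lborel (normal_density 0 (sqrt (1 + r\<^sup>2)))) (A i))"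
    have g_eq: "(\<integral>\<^sup>+ m. g i m s \<partial>density lborel std_normal_density) = (\<Sum>r\<in>{1, 2}. indicator {r} s * L r)" for s
    proof -
      have "(\<integral>\<^sup>+ m. g i m s \<partial>density lborel std_normal_density) =
          (\<Sum>r\<in>{1, 2}. \<integral>\<^sup>+ m. indicator {r} s * (indicator (B i) r *
             emeasure (density lborel (normal_density m r)) (A i)) \<partial>density lborel std_normal_density)"
        unfolding g_def by (rule nn_integral_sum) measurable
      also have "\<dots> = (\<Sum>r\<in>{1, 2}. indicator {r} s * L r)"
      proof (rule sum.cong[OF refl])
        fix r :: real assume "r \<in> {1, 2}"
        then have "r > 0" by auto
        then show "(\<integral>\<^sup>+ m. indicator {r} s * (indicator (B i) r *
            emeasure (density lborel (normal_density m r)) (A i)) \<partial>density lborel std_normal_density) =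
            indicator {r} s * L r"
          by (simp add: nn_integral_cmult nn_integral_emeasure_normal L_def)
      qed
      finally show ?thesis .
    qed
    have "(\<integral>\<^sup>+ \<omega>. (\<integral>\<^sup>+ m. g i m (\<sigma> i \<omega>) \<partial>density lborel std_normal_density) \<partial>M) =
        (\<Sum>r\<in>{1, 2}. \<integral>\<^sup>+ \<omega>. indicator {r} (\<sigma> i \<omega>) * L r \<partial>M)"
      unfolding g_eq by (rule nn_integral_sum) measurable
    also have "\<dots> = (\<Sum>r\<in>{1, 2}. ennreal (1 / 2) * L r)"
    proof (rule sum.cong[OF refl])
      fix r :: real assume r: "r \<in> {1, 2}"
      have "(\<integral>\<^sup>+ \<omega>. indicator {r} (\<sigma> i \<omega>) * L r \<partial>M) = (\<integral>\<^sup>+ \<omega>. indicator {\<omega> \<in> space M. \<sigma> i \<omega> = r} \<omega> * L r \<partial>M)"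
        by (rule nn_integral_cong) (simp add: indicator_def)
      also have "\<dots> = emeasure M {\<omega> \<in> space M. \<sigma> i \<omega> = r} * L r"
        by (simp add: nn_integral_multc)
      also have "emeasure M {\<omega> \<in> space M. \<sigma> i \<omega> = r} = ennreal (1 / 2)"
      proof -
        have "prob {\<omega> \<in> space M. \<sigma> i \<omega> = r} = 1 / 2" using distr_\<sigma>[OF i] r by blast
        then show ?thesis by (simp only: emeasure_eq_measure)
      qed
      finally show "(\<integral>\<^sup>+ \<omega>. indicator {r} (\<sigma> i \<omega>) * L r \<partial>M) = ennreal (1 / 2) * L r" .
    qed
    also have "\<dots> = (\<Sum>r\<in>{1, 2}. ennreal (1 / 2) * (indicator (B i) r *
       emeasure (density lborel (normal_density 0 (sqrt (1 + r\<^sup>2)))) (A i)))"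
      unfolding L_def ..
    finally show "(\<integral>\<^sup>+ \<omega>. (\<integral>\<^sup>+ m. g i m (\<sigma> i \<omega>) \<partial>density lborel std_normal_density) \<partial>M) = \<dots>" .
  qed
  also have "G \<inter> E = {\<omega> \<in> space M. \<forall>i\<in>{1..n}. \<sigma> i \<omega> \<in> B i \<and> X i \<omega> \<in> A i}"
    by (auto simp: G_def E_def)
  finally show ?thesis .
qed

text \<open>Choosing the whole line for every other coordinate makes the remaining factors equal to
  one.\<close>

lemma emeasure_\<sigma>_X_single:
  assumes "i \<in> {1..n}" "B \<in> sets borel" "A \<in> sets borel"
  shows "emeasure M {\<omega> \<in> space M. \<sigma> i \<omega> \<in> B \<and> X i \<omega> \<in> A} =
    (\<Sum>r\<in>{1, 2}. ennreal (1 / 2) * (indicator B r *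
       emeasure (density lborel (normal_density 0 (sqrt (1 + r\<^sup>2)))) A))"
proof -
  have one: "emeasure (density lborel (normal_density 0 (sqrt (1 + r\<^sup>2)))) UNIV = 1" for r :: real
  proof -
    have "1 + r\<^sup>2 > 0" by (rule add_pos_nonneg) auto
    then have "prob_space (density lborel (normal_density 0 (sqrt (1 + r\<^sup>2))))"
      by (intro prob_space_normal_density) simp
    from prob_space.emeasure_space_1[OF this] show ?thesis by simp
  qed
  have "(\<Sum>r\<in>{1, 2 :: real}. ennreal (1 / 2)) = 1"
    by (subst sum_ennreal) auto
  then have full: "(\<Sum>r\<in>{1, 2 :: real}. ennreal (1 / 2) * (indicator UNIV r *
      emeasure (density lborel (normal_density 0 (sqrt (1 + r\<^sup>2)))) UNIV)) = 1"
    by (simp only: one indicator_UNIV mult_1_right)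
  have "(\<Prod>j=1..n. \<Sum>r\<in>{1, 2}. ennreal (1 / 2) * (indicator (if j = i then B else UNIV) r *
       emeasure (density lborel (normal_density 0 (sqrt (1 + r\<^sup>2)))) (if j = i then A else UNIV))) =
    (\<Prod>j=1..n. if j = i then \<Sum>r\<in>{1, 2}. ennreal (1 / 2) * (indicator B r *
       emeasure (density lborel (normal_density 0 (sqrt (1 + r\<^sup>2)))) A) else 1)"
    by (intro prod.cong refl) (simp only: full if_True if_False refl split: if_split, simp)
  moreover have "{\<omega> \<in> space M. \<forall>j\<in>{1..n}. \<sigma> j \<omega> \<in> (if j = i then B else UNIV) \<and> X j \<omega> \<in> (if j = i then A else UNIV)} =
      {\<omega> \<in> space M. \<sigma> i \<omega> \<in> B \<and> X i \<omega> \<in> A}"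
    using assms(1) by (auto split: if_splits)
  ultimately show ?thesis
    using emeasure_\<sigma>_X[of "\<lambda>j. if j = i then B else UNIV" "\<lambda>j. if j = i then A else UNIV"] assms
    by (simp add: prod.delta)
qed

text \<open>Rectangles form an intersection-stable generator of the product sigma-algebra, and on
  them the joint probability is the product of the single-unit probabilities.\<close>

lemma indep_\<sigma>_X:
  "indep_vars (\<lambda>_. borel \<Otimes>\<^sub>M borel) (\<lambda>i \<omega>. (\<sigma> i \<omega>, X i \<omega>)) {1..n}"
proof (cases "n = 0")
  case True
  then show ?thesis by (simp add: indep_vars_def indep_sets_def)
next
  case False
  let ?R = "{B \<times> A | B A. B \<in> sets borel \<and> A \<in> sets borel} :: (real \<times> real) set set"
  have [measurable]: "i \<in> {1..n} \<Longrightarrow> X i \<in> borel_measurable M" for i by (rule measurable_X)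
  have "indep_vars (\<lambda>_. borel \<Otimes>\<^sub>M borel) (\<lambda>i \<omega>. (\<sigma> i \<omega>, X i \<omega>)) {1..n} \<longleftrightarrow>
    (\<forall>R\<in>{1..n} \<rightarrow> ?R. prob (\<Inter>i\<in>{1..n}. (\<lambda>\<omega>. (\<sigma> i \<omega>, X i \<omega>)) -` R i \<inter> space M) =
      (\<Prod>i\<in>{1..n}. prob ((\<lambda>\<omega>. (\<sigma> i \<omega>, X i \<omega>)) -` R i \<inter> space M)))"
  proof (rule indep_vars_finite)
    show "Int_stable ?R"
      by (rule Int_stable_pair_measure_generator)
    show "space (borel \<Otimes>\<^sub>M borel) \<in> ?R"
      unfolding space_pair_measure by (auto intro!: exI[of _ UNIV])
    show "sets (borel \<Otimes>\<^sub>M borel) = sigma_sets (space (borel \<Otimes>\<^sub>M borel)) ?R"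
      unfolding sets_pair_measure space_pair_measure ..
    show "?R \<subseteq> Pow (space (borel \<Otimes>\<^sub>M borel))"
      unfolding space_pair_measure by simp
    show "(\<lambda>\<omega>. (\<sigma> i \<omega>, X i \<omega>)) \<in> M \<rightarrow>\<^sub>M borel \<Otimes>\<^sub>M borel" if "i \<in> {1..n}" for i
      using that by measurable
  qed (use False in simp_all)
  moreover have "prob (\<Inter>i\<in>{1..n}. (\<lambda>\<omega>. (\<sigma> i \<omega>, X i \<omega>)) -` R i \<inter> space M) =
      (\<Prod>i\<in>{1..n}. prob ((\<lambda>\<omega>. (\<sigma> i \<omega>, X i \<omega>)) -` R i \<inter> space M))"
    if R: "R \<in> {1..n} \<rightarrow> ?R" for R
  proof -
    have "\<forall>i\<in>{1..n}. \<exists>B A. R i = B \<times> A \<and> B \<in> sets borel \<and> A \<in> sets borel"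
    proof
      fix i assume "i \<in> {1..n}"
      then have "R i \<in> ?R" using R by (rule Pi_mem[rotated])
      then show "\<exists>B A. R i = B \<times> A \<and> B \<in> sets borel \<and> A \<in> sets borel" by blast
    qed
    then obtain B A where BA: "\<And>i. i \<in> {1..n} \<Longrightarrow> R i = B i \<times> A i"
        "\<And>i. i \<in> {1..n} \<Longrightarrow> B i \<in> sets borel" "\<And>i. i \<in> {1..n} \<Longrightarrow> A i \<in> sets borel"
      by metis
    have "(\<Inter>i\<in>{1..n}. (\<lambda>\<omega>. (\<sigma> i \<omega>, X i \<omega>)) -` R i \<inter> space M) =
        {\<omega> \<in> space M. \<forall>i\<in>{1..n}. \<sigma> i \<omega> \<in> B i \<and> X i \<omega> \<in> A i}"
    proof (intro set_eqI iffI)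
      fix \<omega> assume *: "\<omega> \<in> (\<Inter>i\<in>{1..n}. (\<lambda>\<omega>. (\<sigma> i \<omega>, X i \<omega>)) -` R i \<inter> space M)"
      moreover have "1 \<in> {1..n}" using False by simp
      ultimately have "\<omega> \<in> space M" by blast
      moreover have "\<sigma> i \<omega> \<in> B i \<and> X i \<omega> \<in> A i" if "i \<in> {1..n}" for i
      proof -
        have "(\<sigma> i \<omega>, X i \<omega>) \<in> R i" using * that by blast
        then show ?thesis using BA(1)[OF that] by simp
      qed
      ultimately show "\<omega> \<in> {\<omega> \<in> space M. \<forall>i\<in>{1..n}. \<sigma> i \<omega> \<in> B i \<and> X i \<omega> \<in> A i}"
        by blast
    qed (simp add: BA(1))
    then have "ennreal (prob (\<Inter>i\<in>{1..n}. (\<lambda>\<omega>. (\<sigma> i \<omega>, X i \<omega>)) -` R i \<inter> space M)) =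
      (\<Prod>i=1..n. \<Sum>r\<in>{1, 2}. ennreal (1 / 2) * (indicator (B i) r *
       emeasure (density lborel (normal_density 0 (sqrt (1 + r\<^sup>2)))) (A i)))"
      using emeasure_\<sigma>_X[of B A] BA by (simp add: emeasure_eq_measure)
    also have "\<dots> = (\<Prod>i=1..n. emeasure M {\<omega> \<in> space M. \<sigma> i \<omega> \<in> B i \<and> X i \<omega> \<in> A i})"
      using BA by (intro prod.cong refl emeasure_\<sigma>_X_single[symmetric]) auto
    also have "\<dots> = (\<Prod>i=1..n. ennreal (prob ((\<lambda>\<omega>. (\<sigma> i \<omega>, X i \<omega>)) -` R i \<inter> space M)))"
      unfolding emeasure_eq_measure using BA(1)
      by (intro prod.cong refl arg_cong[of _ _ "\<lambda>S. ennreal (prob S)"]) auto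
    also have "\<dots> = ennreal (\<Prod>i=1..n. prob ((\<lambda>\<omega>. (\<sigma> i \<omega>, X i \<omega>)) -` R i \<inter> space M))"
      by (rule prod_ennreal) simp
    finally show ?thesis
      by (subst (asm) ennreal_inj) (auto intro!: prod_nonneg)
  qed
  ultimately show ?thesis by blast
qed

lemma measurable_\<theta> [measurable]: "i \<in> {1..n} \<Longrightarrow> \<theta> i \<in> borel_measurable M"
  unfolding oracle_score_def[abs_def] posterior_mean_def using measurable_X[of i] by measurable

lemma indep_\<sigma>_\<theta>: "indep_vars (\<lambda>_. borel \<Otimes>\<^sub>M borel) (\<lambda>i \<omega>. (\<sigma> i \<omega>, \<theta> i \<omega>)) {1..n}"
proof -
  have "indep_vars (\<lambda>_. borel \<Otimes>\<^sub>M borel) (\<lambda>i \<omega>. (\<lambda>(s, x). (s, posterior_mean 0 s x)) (\<sigma> i \<omega>, X i \<omega>)) {1..n}"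
    by (rule indep_vars_compose2[OF indep_\<sigma>_X]) (unfold posterior_mean_def, measurable)
  then show ?thesis by (simp add: oracle_score_def)
qed

lemma prob_\<sigma>_\<theta>:
  assumes i: "i \<in> {1..n}" and r: "r \<in> {1, 2}" and A [measurable]: "A \<in> sets borel"
  shows "prob {\<omega> \<in> space M. \<sigma> i \<omega> = r \<and> \<theta> i \<omega> \<in> A} =
    1 / 2 * measure (score_law r) A"
proof -
  have pos: "1 + r\<^sup>2 > 0" by (rule add_pos_nonneg) auto
  define N where "N = density lborel (normal_density 0 (sqrt (1 + r\<^sup>2)))"
  interpret N: prob_space N
    unfolding N_def using pos by (intro prob_space_normal_density) simp
  have "distributed N lborel (\<lambda>x. x) (normal_density 0 (sqrt (1 + r\<^sup>2)))"
    by (auto simp: distributed_def N_def distr_id2)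
  from N.normal_density_affine[OF this, of "1 / (1 + r\<^sup>2)" 0]
  have "distributed N lborel (\<lambda>x. x / (1 + r\<^sup>2)) (normal_density 0 (sqrt (1 + r\<^sup>2) / (1 + r\<^sup>2)))"
    using pos by simp
  also have "sqrt (1 + r\<^sup>2) / (1 + r\<^sup>2) = 1 / sqrt (1 + r\<^sup>2)"
    using pos by (simp add: divide_simps)
  finally have "score_law r = distr N lborel (\<lambda>x. x / (1 + r\<^sup>2))"
    by (simp add: distributed_distr_eq_density score_law_def)
  then have "measure (score_law r) A = measure N ((\<lambda>x. x / (1 + r\<^sup>2)) -` A)"
    by (simp add: measure_distr N_def)
  moreover have "(\<lambda>x. x / (1 + r\<^sup>2)) -` A \<in> sets borel"
    by (rule measurable_sets_borel[OF _ A]) measurable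
  then have "emeasure M {\<omega> \<in> space M. \<sigma> i \<omega> \<in> {r} \<and> X i \<omega> \<in> (\<lambda>x. x / (1 + r\<^sup>2)) -` A} =
      ennreal (1 / 2) * emeasure N ((\<lambda>x. x / (1 + r\<^sup>2)) -` A)"
    using r by (subst emeasure_\<sigma>_X_single[OF i]) (auto simp: N_def)
  moreover have "{\<omega> \<in> space M. \<sigma> i \<omega> \<in> {r} \<and> X i \<omega> \<in> (\<lambda>x. x / (1 + r\<^sup>2)) -` A} =
      {\<omega> \<in> space M. \<sigma> i \<omega> = r \<and> \<theta> i \<omega> \<in> A}"
    by (auto simp: oracle_score_def posterior_mean_def add.commute)
  ultimately have "ennreal (prob {\<omega> \<in> space M. \<sigma> i \<omega> = r \<and> \<theta> i \<omega> \<in> A}) =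
      ennreal (1 / 2 * measure (score_law r) A)"
    unfolding emeasure_eq_measure N.emeasure_eq_measure by (simp only: ennreal_mult'[symmetric])
  then show ?thesis
    by (subst (asm) ennreal_inj) auto
qed

end

subsection \<open>Limit law of the sum and concentration of the counts\<close>

lemma score_law_sd_pos: "0 < 1 / sqrt (1 + r\<^sup>2)"
proof -
  have "1 + r\<^sup>2 > 0" by (rule add_pos_nonneg) auto
  then show ?thesis by simp
qed

lemma real_distribution_score_law: "real_distribution (score_law r)"
  unfolding score_law_def real_distribution_def real_distribution_axioms_def
  using prob_space_normal_density[OF score_law_sd_pos] by auto

lemma sets_score_law [measurable_cong, simp]: "sets (score_law r) = sets borel"
  by (simp add: score_law_def)

lemma char_score_law: "char (score_law r) t = exp (- t\<^sup>2 / (2 * (1 + r\<^sup>2)))"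
proof -
  interpret S: prob_space std_normal_distribution
    by (rule prob_space_normal_density) simp
  let ?s = "1 / sqrt (1 + r\<^sup>2)"
  have "distributed std_normal_distribution lborel (\<lambda>x. x) std_normal_density"
    by (auto simp: distributed_def distr_id2)
  from S.normal_density_affine[OF this, of ?s 0]
  have "distributed std_normal_distribution lborel (\<lambda>x. ?s * x) (normal_density 0 ?s)"
    using score_law_sd_pos[of r] by simp
  then have "score_law r = distr std_normal_distribution borel (\<lambda>x. ?s * x)"
    by (subst distr_cong[of _ _ borel lborel]) (auto simp: distributed_distr_eq_density score_law_def)
  then have "char (score_law r) t = char std_normal_distribution (t * ?s)"
    by (simp add: char_def integral_distr mult_ac)
  also have "(t * ?s)\<^sup>2 = t\<^sup>2 / (1 + r\<^sup>2)"
  proof -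
    have "1 + r\<^sup>2 \<ge> 0" by simp
    then show ?thesis by (simp add: power_mult_distrib power_divide)
  qed
  then have "char std_normal_distribution (t * ?s) = exp (- t\<^sup>2 / (2 * (1 + r\<^sup>2)))"
    by (simp add: char_std_normal_distribution mult.commute)
  finally show ?thesis .
qed

context normal_means_model
begin

lemma prob_\<theta>:
  assumes i: "i \<in> {1..n}" and A [measurable]: "A \<in> sets borel"
  shows "prob {\<omega> \<in> space M. \<theta> i \<omega> \<in> A} = (measure (score_law 1) A + measure (score_law 2) A) / 2"
proof -
  note [measurable] = i
  have "prob {\<omega> \<in> space M. \<theta> i \<omega> \<in> A} =
      prob ({\<omega> \<in> space M. \<sigma> i \<omega> = 1 \<and> \<theta> i \<omega> \<in> A} \<union> {\<omega> \<in> space M. \<sigma> i \<omega> = 2 \<and> \<theta> i \<omega> \<in> A})"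
    using AE_\<sigma> by (intro measure_eq_AE) (auto elim!: eventually_mono simp: i[simplified] dest: bspec[OF _ i])
  also have "\<dots> = prob {\<omega> \<in> space M. \<sigma> i \<omega> = 1 \<and> \<theta> i \<omega> \<in> A} + prob {\<omega> \<in> space M. \<sigma> i \<omega> = 2 \<and> \<theta> i \<omega> \<in> A}"
    by (rule finite_measure_Union) auto
  finally show ?thesis
    using prob_\<sigma>_\<theta>[OF i _ A, of 1] prob_\<sigma>_\<theta>[OF i _ A, of 2] by simp
qed

lemma indep_\<theta>: "indep_vars (\<lambda>_. borel) \<theta> {1..n}"
  using indep_vars_compose2[OF indep_\<sigma>_\<theta>, of "\<lambda>_. snd" "\<lambda>_. borel"] by simp

text \<open>The score is an equal mixture of centred normals with variances 1/2 and 1/5, and the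
  integral against the mixture density splits accordingly.\<close>

lemma char_\<theta>:
  assumes i: "i \<in> {1..n}"
  shows "char (distr M borel (\<theta> i)) t = (exp (- t\<^sup>2 / 4) + exp (- t\<^sup>2 / 10)) / 2"
proof -
  note [measurable] = i
  let ?f = "\<lambda>r. normal_density 0 (1 / sqrt (1 + r\<^sup>2))"
  interpret L: real_distribution "score_law r" for r by (rule real_distribution_score_law)
  have half: "ennreal ((a + b) / 2) = ennreal (1 / 2) * (ennreal a + ennreal b)" if "a \<ge> 0" "b \<ge> 0" for a b
    using that by (subst ennreal_plus[symmetric], simp, simp, subst ennreal_mult[symmetric]) auto
  have "distr M borel (\<theta> i) = density lborel (\<lambda>x. (?f 1 x + ?f 2 x) / 2)"
  proof (rule measure_eqI)
    fix A assume "A \<in> sets (distr M borel (\<theta> i))"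
    then have A [measurable]: "A \<in> sets borel" by simp
    have "emeasure (distr M borel (\<theta> i)) A = ennreal (prob {\<omega> \<in> space M. \<theta> i \<omega> \<in> A})"
      by (subst emeasure_distr) (auto simp: emeasure_eq_measure vimage_def Int_def conj_commute)
    also have "\<dots> = ennreal (1 / 2) * (emeasure (score_law 1) A + emeasure (score_law 2) A)"
      unfolding prob_\<theta>[OF i A] L.emeasure_eq_measure by (rule half) auto
    also have "\<dots> = (\<integral>\<^sup>+ x. ennreal (1 / 2) * (ennreal (?f 1 x) * indicator A x + ennreal (?f 2 x) * indicator A x) \<partial>lborel)"
      unfolding score_law_def
      by (subst nn_integral_cmult) (simp_all add: nn_integral_add emeasure_density)
    also have "\<dots> = (\<integral>\<^sup>+ x. ennreal ((?f 1 x + ?f 2 x) / 2) * indicator A x \<partial>lborel)"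
    proof (rule nn_integral_cong)
      fix x
      have "ennreal ((?f 1 x + ?f 2 x) / 2) = ennreal (1 / 2) * (ennreal (?f 1 x) + ennreal (?f 2 x))"
        by (rule half) auto
      then show "ennreal (1 / 2) * (ennreal (?f 1 x) * indicator A x + ennreal (?f 2 x) * indicator A x) =
          ennreal ((?f 1 x + ?f 2 x) / 2) * indicator A x"
        by (simp only: distrib_left distrib_right mult.assoc)
    qed
    also have "\<dots> = emeasure (density lborel (\<lambda>x. (?f 1 x + ?f 2 x) / 2)) A"
      by (simp add: emeasure_density)
    finally show "emeasure (distr M borel (\<theta> i)) A = \<dots>" .
  qed simp
  then have "char (distr M borel (\<theta> i)) t = (\<integral>x. ((?f 1 x + ?f 2 x) / 2) *\<^sub>R iexp (t * x) \<partial>lborel)"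
    by (simp add: char_def integral_density)
  also have "\<dots> = (\<integral>x. (1 / 2) *\<^sub>R (?f 1 x *\<^sub>R iexp (t * x) + ?f 2 x *\<^sub>R iexp (t * x)) \<partial>lborel)"
    by (intro Bochner_Integration.integral_cong refl) (simp flip: scaleR_add_left)
  also have "\<dots> = (1 / 2) *\<^sub>R ((\<integral>x. ?f 1 x *\<^sub>R iexp (t * x) \<partial>lborel) + (\<integral>x. ?f 2 x *\<^sub>R iexp (t * x) \<partial>lborel))"
  proof -
    have "integrable lborel (\<lambda>x. ?f r x *\<^sub>R iexp (t * x))" for r
    proof (rule Bochner_Integration.integrable_bound)
      show "integrable lborel (?f r)" by (rule integrable_normal_density) (rule score_law_sd_pos)
    qed (auto simp: norm_mult)
    from this[of 1] this[of 2] show ?thesis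
      by (subst integral_scaleR_right, subst Bochner_Integration.integral_add) auto
  qed
  also have "\<dots> = (1 / 2) *\<^sub>R (char (score_law 1) t + char (score_law 2) t)"
    by (simp add: char_def score_law_def integral_density)
  finally show ?thesis
    by (simp add: char_score_law scaleR_conv_of_real)
qed

lemma char_sum_\<theta>:
  "char (distr M borel (\<lambda>\<omega>. c * (\<Sum>i=1..n. \<theta> i \<omega>))) t =
     of_real (((exp (- (c * t)\<^sup>2 / 4) + exp (- (c * t)\<^sup>2 / 10)) / 2) ^ n)"
proof -
  have [measurable]: "(\<lambda>\<omega>. \<Sum>i=1..n. \<theta> i \<omega>) \<in> borel_measurable M" by measurable
  have "char (distr M borel (\<lambda>\<omega>. c * (\<Sum>i=1..n. \<theta> i \<omega>))) t = char (distr M borel (\<lambda>\<omega>. \<Sum>i=1..n. \<theta> i \<omega>)) (c * t)"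
    by (simp add: char_def integral_distr mult_ac)
  also have "\<dots> = (\<Prod>i=1..n. char (distr M borel (\<theta> i)) (c * t))"
    by (rule char_distr_sum) (rule indep_\<theta>)
  also have "\<dots> = (\<Prod>i=1..n. of_real ((exp (- (c * t)\<^sup>2 / 4) + exp (- (c * t)\<^sup>2 / 10)) / 2))"
    by (intro prod.cong refl, subst char_\<theta>) auto
  finally show ?thesis by simp
qed

text \<open>The count is a sum of independent indicators with common mean \<open>q\<close>.
  Comparing it with \<open>m\<close> at one fixed point on either side of the population quantile
  traps the Bayes threshold between the two points.\<close>

lemma Hoeffding_\<theta>:
  fixes x e q :: real
  defines "q \<equiv> (measure (score_law 1) {x<..} + measure (score_law 2) {x<..}) / 2"
  assumes "n \<ge> 1" "e \<ge> 0"
  shows "prob {\<omega> \<in> space M. real (card {i \<in> {1..n}. x < \<theta> i \<omega>}) \<ge> n * q + e} \<le> exp (- 2 * e\<^sup>2 / n)"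
    and "prob {\<omega> \<in> space M. real (card {i \<in> {1..n}. x < \<theta> i \<omega>}) \<le> n * q - e} \<le> exp (- 2 * e\<^sup>2 / n)"
proof -
  let ?I = "\<lambda>i \<omega>. indicat_real {x<..} (\<theta> i \<omega>)"
  have ind: "indep_vars (\<lambda>_. borel) ?I {1..n}"
    by (rule indep_vars_compose2[OF indep_\<theta>]) auto
  have "expectation (?I i) = q" if [measurable]: "i \<in> {1..n}" for i
  proof -
    have "expectation (?I i) = (\<integral>\<omega>. indicator {\<omega> \<in> space M. \<theta> i \<omega> \<in> {x<..}} \<omega> \<partial>M)"
      by (intro Bochner_Integration.integral_cong) (auto simp: indicator_def)
    also have "\<dots> = prob {\<omega> \<in> space M. \<theta> i \<omega> \<in> {x<..}}" by simp
    also have "\<dots> = q" unfolding q_def by (rule prob_\<theta>) (use that in auto)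
    finally show ?thesis .
  qed
  then have mean: "(\<Sum>i\<in>{1..n}. expectation (?I i)) = n * q" by simp
  interpret Hoeffding_ineq M "{1..n}" ?I "\<lambda>_. 0" "\<lambda>_. 1" "n * q"
    by unfold_locales (use ind mean in \<open>auto simp: indicator_def\<close>)
  have card: "real (card {i \<in> {1..n}. x < \<theta> i \<omega>}) = (\<Sum>i\<in>{1..n}. ?I i \<omega>)" for \<omega>
    by (simp add: indicator_def sum.If_cases Int_def)
  have n: "(\<Sum>i\<in>{1..n}. (1 - 0 :: real)\<^sup>2) = n" by simp
  show "prob {\<omega> \<in> space M. real (card {i \<in> {1..n}. x < \<theta> i \<omega>}) \<ge> n * q + e} \<le> exp (- 2 * e\<^sup>2 / n)"
    using Hoeffding_ineq_ge[OF \<open>e \<ge> 0\<close>] \<open>n \<ge> 1\<close> unfolding card n by simp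
  show "prob {\<omega> \<in> space M. real (card {i \<in> {1..n}. x < \<theta> i \<omega>}) \<le> n * q - e} \<le> exp (- 2 * e\<^sup>2 / n)"
    using Hoeffding_ineq_le[OF \<open>e \<ge> 0\<close>] \<open>n \<ge> 1\<close> unfolding card n by simp
qed

text \<open>Markov's inequality for exp(-count), whose expectation factorises over the units. Each
  noise level has probability 1/2, so a unit lands in the cell with probability at least
  \<open>q\<close>.\<close>

lemma Chernoff_\<sigma>_\<theta>:
  fixes q :: real
  assumes r: "r \<in> {1, 2}" and A [measurable]: "A \<in> sets borel"
    and q: "2 * q \<le> measure (score_law r) A"
  shows "prob {\<omega> \<in> space M. real (card {i \<in> {1..n}. \<sigma> i \<omega> = r \<and> \<theta> i \<omega> \<in> A}) < n * q / 4} \<le> exp (- n * q / 4)"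
proof -
  interpret L: real_distribution "score_law r" by (rule real_distribution_score_law)
  let ?I = "\<lambda>i \<omega>. indicat_real ({r} \<times> A) (\<sigma> i \<omega>, \<theta> i \<omega>)"
  let ?Y = "\<lambda>\<omega>. \<Prod>i\<in>{1..n}. exp (- ?I i \<omega>)"
  have rA [measurable]: "{r} \<times> A \<in> sets (borel \<Otimes>\<^sub>M borel)" by measurable
  have ind: "indep_vars (\<lambda>_. borel) (\<lambda>i \<omega>. exp (- ?I i \<omega>)) {1..n}"
    by (rule indep_vars_compose2[OF indep_\<sigma>_\<theta>, where Y = "\<lambda>_ p. exp (- indicat_real ({r} \<times> A) p)"]) measurable
  have [measurable]: "?I i \<in> borel_measurable M" if [measurable]: "i \<in> {1..n}" for i by measurable
  have int: "integrable M (\<lambda>\<omega>. exp (- ?I i \<omega>))" if [measurable]: "i \<in> {1..n}" for i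
    by (rule integrable_const_bound[where B = 1]) (auto simp: indicator_def)
  have exp1: "exp (- 1 :: real) \<le> 1 / 2"
    using exp_ge_add_one_self[of "1 :: real"] by (simp add: exp_minus field_simps)
  have mean: "expectation (\<lambda>\<omega>. exp (- ?I i \<omega>)) \<le> exp (- q / 2)" if [measurable]: "i \<in> {1..n}" for i
  proof -
    have "expectation (\<lambda>\<omega>. exp (- ?I i \<omega>)) =
        expectation (\<lambda>\<omega>. 1 - (1 - exp (- 1)) * indicator {\<omega> \<in> space M. \<sigma> i \<omega> = r \<and> \<theta> i \<omega> \<in> A} \<omega>)"
      by (intro Bochner_Integration.integral_cong) (auto simp: indicator_def)
    also have "\<dots> = 1 - (1 - exp (- 1)) * (1 / 2 * measure (score_law r) A)"
    proof -
      have "integrable M (indicat_real {\<omega> \<in> space M. \<sigma> i \<omega> = r \<and> \<theta> i \<omega> \<in> A})"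
        by (rule integrable_const_bound[where B = 1]) auto
      then show ?thesis
        using prob_\<sigma>_\<theta>[OF that r A]
        by (subst Bochner_Integration.integral_diff) (auto simp: prob_space)
    qed
    \<comment> \<open>Using 1 - exp(-1) \<ge> 1/2 costs a constant factor only: the expectation
      decays like exp(-nq/2), and comparing with the level nq/4 still leaves the exponent
      nq/4.\<close>
    also have "\<dots> \<le> 1 - 1 / 2 * (1 / 2 * measure (score_law r) A)"
      using exp1 by (intro diff_left_mono mult_right_mono) auto
    also have "\<dots> \<le> 1 - q / 2" using q by simp
    also have "\<dots> \<le> exp (- q / 2)" using exp_ge_add_one_self[of "- q / 2"] by simp
    finally show ?thesis .
  qed
  have "expectation ?Y = (\<Prod>i\<in>{1..n}. expectation (\<lambda>\<omega>. exp (- ?I i \<omega>)))"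
    by (rule indep_vars_lebesgue_integral) (use ind int in auto)
  also have "\<dots> \<le> (\<Prod>i\<in>{1..n}. exp (- q / 2))"
    by (intro prod_mono conjI mean) (auto intro!: integral_nonneg_AE)
  also have "\<dots> = exp (- n * q / 2)"
    by (simp add: exp_of_nat_mult[symmetric])
  finally have EY: "expectation ?Y \<le> exp (- n * q / 2)" .
  have intY: "integrable M ?Y"
    by (rule indep_vars_integrable) (use ind int in auto)
  have "prob {\<omega> \<in> space M. real (card {i \<in> {1..n}. \<sigma> i \<omega> = r \<and> \<theta> i \<omega> \<in> A}) < n * q / 4} \<le>
      prob {\<omega> \<in> space M. exp (- n * q / 4) \<le> ?Y \<omega>}"
  proof (rule finite_measure_mono)
    have "?Y \<omega> = exp (- real (card {i \<in> {1..n}. \<sigma> i \<omega> = r \<and> \<theta> i \<omega> \<in> A}))" for \<omega>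
    proof -
      have "?Y \<omega> = exp (- (\<Sum>i\<in>{1..n}. ?I i \<omega>))"
        by (simp add: exp_sum[symmetric] sum_negf)
      also have "(\<Sum>i\<in>{1..n}. ?I i \<omega>) = real (card {i \<in> {1..n}. \<sigma> i \<omega> = r \<and> \<theta> i \<omega> \<in> A})"
        by (simp add: indicator_def sum.If_cases Int_def)
      finally show ?thesis .
    qed
    then show "{\<omega> \<in> space M. real (card {i \<in> {1..n}. \<sigma> i \<omega> = r \<and> \<theta> i \<omega> \<in> A}) < n * q / 4} \<subseteq>
        {\<omega> \<in> space M. exp (- n * q / 4) \<le> ?Y \<omega>}"
      by auto
    show "{\<omega> \<in> space M. exp (- n * q / 4) \<le> ?Y \<omega>} \<in> events" by measurable
  qed
  also have "\<dots> \<le> expectation ?Y / exp (- n * q / 4)"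
    by (rule integral_Markov_inequality_measure[OF intY, where A = "{}"]) (auto intro!: prod_nonneg)
  also have "\<dots> \<le> exp (- n * q / 2) / exp (- n * q / 4)"
    using EY by (intro divide_right_mono) auto
  also have "\<dots> = exp (- n * q / 4)"
    by (simp add: exp_diff[symmetric])
  finally show ?thesis .
qed

end

text \<open>Every sample size has its own probability space, so the limit is taken for laws, through
  their characteristic functions. The scale comes from the variance of one score, 7/20 = (1/2 + 1/5)
  / 2.\<close>

lemma sum_scores_CLT:
  assumes "\<And>n. n \<ge> 1 \<Longrightarrow> normal_means_model (M n) n (\<mu> n) (\<sigma> n) (X n)"
  shows "(\<lambda>n. measure (M n) {\<omega> \<in> space (M n). (\<Sum>i=1..n. oracle_score (\<sigma> n) (X n) i \<omega>) \<le> - sqrt (7 / 20 * n)})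
    \<longlonglongrightarrow> cdf std_normal_distribution (- 1)"
proof -
  \<comment> \<open>The model is available for positive sample sizes only, so the sequence is
    indexed by \<open>Suc n\<close> and shifted back at the end.\<close>
  define c where "c = (\<lambda>n. 1 / sqrt (7 / 20 * real (Suc n)))"
  define S where "S = (\<lambda>n \<omega>. \<Sum>i=1..Suc n. oracle_score (\<sigma> (Suc n)) (X (Suc n)) i \<omega>)"
  define D where "D = (\<lambda>n. distr (M (Suc n)) borel (\<lambda>\<omega>. c n * S n \<omega>))"
  interpret normal_means_model "M (Suc n)" "Suc n" "\<mu> (Suc n)" "\<sigma> (Suc n)" "X (Suc n)" for n
    by (rule assms) simp
  have [measurable]: "S n \<in> borel_measurable (M (Suc n))" for n
    unfolding S_def by measurable
  have c: "c n > 0" for n by (simp add: c_def)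
  have "weak_conv_m D std_normal_distribution"
  proof (rule levy_continuity)
    fix t :: real
    have "char (D n) t = of_real (((exp (- (c n * t)\<^sup>2 / 4) + exp (- (c n * t)\<^sup>2 / 10)) / 2) ^ Suc n)" for n
      unfolding D_def S_def by (rule char_sum_\<theta>)
    also have "(c n * t)\<^sup>2 = 20 / 7 * t\<^sup>2 / real (Suc n)" for n
      by (simp add: c_def power_mult_distrib power_divide del: of_nat_Suc)
    finally have char: "char (D n) t = of_real (((exp (- (20 / 7 * t\<^sup>2 / real (Suc n)) / 4) +
        exp (- (20 / 7 * t\<^sup>2 / real (Suc n)) / 10)) / 2) ^ Suc n)" for n .
    \<comment> \<open>The base of the power is 1 - a/(2n) up to order n^(-2), because 20/7 * (1/4 +
      1/10) / 2 = 1/2.\<close>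
    have "(\<lambda>n. ((exp (- (20 / 7 * a / real (Suc n)) / 4) +
        exp (- (20 / 7 * a / real (Suc n)) / 10)) / 2) ^ Suc n) \<longlonglongrightarrow> exp (- a / 2)" for a :: real
      by real_asymp
    then show "(\<lambda>n. char (D n) t) \<longlonglongrightarrow> char std_normal_distribution t"
      unfolding char char_std_normal_distribution by (intro tendsto_of_real)
  qed (auto simp: D_def intro!: real_distribution_distr real_dist_normal_dist)
  moreover have "isCont (cdf std_normal_distribution) (- 1)"
  proof -
    interpret N: real_distribution std_normal_distribution by (rule real_dist_normal_dist)
    show ?thesis
      by (subst N.isCont_cdf) (simp add: measure_def emeasure_density nn_integral_indicator_singleton)
  qed
  ultimately have "(\<lambda>n. cdf (D n) (- 1)) \<longlonglongrightarrow> cdf std_normal_distribution (- 1)"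
    by (simp add: weak_conv_m_def weak_conv_def)
  moreover have "cdf (D n) (- 1) = measure (M (Suc n)) {\<omega> \<in> space (M (Suc n)). S n \<omega> \<le> - sqrt (7 / 20 * Suc n)}" for n
  proof -
    have "cdf (D n) (- 1) = measure (M (Suc n)) {\<omega> \<in> space (M (Suc n)). c n * S n \<omega> \<le> - 1}"
      unfolding cdf_def D_def by (subst measure_distr) (auto intro!: arg_cong[of _ _ "measure _"])
    moreover have "c n * S n \<omega> \<le> - 1 \<longleftrightarrow> S n \<omega> \<le> - sqrt (7 / 20 * Suc n)" for \<omega>
      unfolding c_def by (simp add: field_simps del: of_nat_Suc)
    ultimately show ?thesis by (simp only:)
  qed
  ultimately show ?thesis
    unfolding S_def by (subst filterlim_sequentially_Suc[symmetric]) simp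
qed

subsection \<open>The regret with positive probability\<close>

text \<open>A centred normal density decreases in the absolute value, so its value at |\<tau>| + 1
  bounds it from below on the unit neighbourhood of \<tau>. Short intervals there have mass at least
  proportional to their length, with a constant free of n.\<close>

lemma score_law_Ioo_ge:
  obtains c where "c > 0"
    "\<And>a b. \<tau> - 1 \<le> a \<Longrightarrow> a \<le> b \<Longrightarrow> b \<le> \<tau> + 1 \<Longrightarrow> c * (b - a) \<le> measure (score_law r) {a<..<b}"
proof
  let ?s = "1 / sqrt (1 + r\<^sup>2)"
  let ?c = "normal_density 0 ?s (\<bar>\<tau>\<bar> + 1)"
  interpret L: real_distribution "score_law r" by (rule real_distribution_score_law)
  show "?c > 0" by (rule normal_density_pos) (rule score_law_sd_pos)
  fix a b assume ab: "\<tau> - 1 \<le> a" "a \<le> b" "b \<le> \<tau> + 1"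
  have le: "?c \<le> normal_density 0 ?s y" if "y \<in> {a<..<b}" for y
  proof -
    have "\<bar>y\<bar> \<le> \<bar>\<bar>\<tau>\<bar> + 1\<bar>" using that ab by auto
    then have "y\<^sup>2 \<le> (\<bar>\<tau>\<bar> + 1)\<^sup>2" by (simp only: abs_le_square_iff)
    then show ?thesis
      unfolding normal_density_def
      by (intro mult_left_mono) (auto intro!: divide_right_mono mult_nonneg_nonneg)
  qed
  have "ennreal (?c * (b - a)) = (\<integral>\<^sup>+ y. ennreal ?c * indicator {a<..<b} y \<partial>lborel)"
    using ab by (simp add: nn_integral_cmult ennreal_mult)
  also have "\<dots> \<le> (\<integral>\<^sup>+ y. ennreal (normal_density 0 ?s y) * indicator {a<..<b} y \<partial>lborel)"
    using le by (intro nn_integral_mono) (auto simp: indicator_def intro!: ennreal_leI)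
  also have "\<dots> = emeasure (score_law r) {a<..<b}"
    by (simp add: score_law_def emeasure_density)
  finally show "?c * (b - a) \<le> measure (score_law r) {a<..<b}"
    unfolding L.emeasure_eq_measure by (subst (asm) ennreal_le_iff) auto
qed

lemma cdf_std_normal_pos: "cdf std_normal_distribution (- 1) > 0"
proof -
  interpret N: real_distribution std_normal_distribution by (rule real_dist_normal_dist)
  \<comment> \<open>\<open>score_law 0\<close> is the standard normal law, so the bound around -2
    applies to the interval from -2 to -1.\<close>
  obtain c where "c > 0" and
    c: "\<And>a b. (-2) - 1 \<le> a \<Longrightarrow> a \<le> b \<Longrightarrow> b \<le> (-2) + 1 \<Longrightarrow> c * (b - a) \<le> measure (score_law 0) {a<..<b}"
    by (rule score_law_Ioo_ge[of "-2" 0]) blast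
  have "0 < measure std_normal_distribution {-2<..<-1}"
    using c[of "-2" "-1"] \<open>c > 0\<close> by (simp add: score_law_def)
  also have "\<dots> \<le> cdf std_normal_distribution (- 1)"
    unfolding cdf_def by (rule N.finite_measure_mono) auto
  finally show ?thesis .
qed

text \<open>The sum of the two distribution functions is continuous and runs from 0 to 2, so the
  intermediate value theorem applies. The right-hand side is \<open>2 * \<alpha>\<close> because the
  score law averages the two tails.\<close>

lemma score_quantile_exists:
  assumes "0 < \<alpha>" "\<alpha> < 1"
  obtains \<tau> where "measure (score_law 1) {\<tau><..} + measure (score_law 2) {\<tau><..} = 2 * \<alpha>"
proof -
  interpret L: real_distribution "score_law r" for r by (rule real_distribution_score_law)
  define F where "F = (\<lambda>x. cdf (score_law 1) x + cdf (score_law 2) x)"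
  have cont: "isCont (cdf (score_law r)) x" for r x
    by (subst L.isCont_cdf)
      (simp add: score_law_def measure_def emeasure_density nn_integral_indicator_singleton)
  have "(F \<longlongrightarrow> 0 + 0) at_bot" unfolding F_def by (intro tendsto_add L.cdf_lim_at_bot)
  then have "eventually (\<lambda>x. F x < 2 * (1 - \<alpha>)) at_bot"
    by (rule order_tendstoD) (use assms in auto)
  then obtain u where u: "\<And>x. x \<le> u \<Longrightarrow> F x < 2 * (1 - \<alpha>)" unfolding eventually_at_bot_linorder by blast
  have "(F \<longlongrightarrow> 1 + 1) at_top" unfolding F_def by (intro tendsto_add L.cdf_lim_at_top_prob)
  then have "eventually (\<lambda>x. F x > 2 * (1 - \<alpha>)) at_top"
    by (rule order_tendstoD) (use assms in auto)
  then obtain v where v: "\<And>x. x \<ge> v \<Longrightarrow> F x > 2 * (1 - \<alpha>)" unfolding eventually_at_top_linorder by blast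
  have "\<exists>x\<ge>u. x \<le> max u v \<and> F x = 2 * (1 - \<alpha>)"
    using u[of u] v[of "max u v"] cont unfolding F_def
    by (intro IVT) (auto intro!: continuous_intros)
  then obtain \<tau> where \<tau>: "F \<tau> = 2 * (1 - \<alpha>)" by blast
  have "measure (score_law r) {\<tau><..} = 1 - cdf (score_law r) \<tau>" for r
  proof -
    have "{\<tau><..} = UNIV - {..\<tau>}" by auto
    then show ?thesis
      using L.prob_compl[of "{..\<tau>}" r] by (simp add: cdf_def)
  qed
  then show ?thesis using \<tau> by (intro that[of \<tau>]) (simp add: F_def)
qed

context normal_means_model
begin

text \<open>
  On the good event, the Bayes threshold lies within \<open>K / sqrt n\<close> of the population quantile
  \<open>\<tau>\<close>, and each of the \<open>2 L + 1\<close> cells of width \<open>1 / (24 sqrt n)\<close> around \<open>\<tau>\<close> contains of the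
  order of \<open>sqrt n\<close> units of either noise level.
\<close>

lemma prob_selection_regret_ge:
  fixes \<alpha> \<tau> c K :: real and L :: int
  assumes n: "n \<ge> 1" and \<alpha>: "0 < \<alpha>" "\<alpha> < 1" "1 \<le> \<alpha> * n"
    and mle: "\<And>\<omega>. \<omega> \<in> space M \<Longrightarrow> is_mle n (\<lambda>i. \<sigma> i \<omega>) (\<lambda>i. X i \<omega>) (\<eta> \<omega>)"
    and ties: "random_tie_break M n \<mu> \<sigma> X \<pi>B" "random_tie_break M n \<mu> \<sigma> X \<pi>E"
    and \<tau>: "measure (score_law 1) {\<tau><..} + measure (score_law 2) {\<tau><..} = 2 * \<alpha>"
    and c: "c > 0" "\<And>r a b. r \<in> {1, 2} \<Longrightarrow> \<tau> - 1 \<le> a \<Longrightarrow> a \<le> b \<Longrightarrow> b \<le> \<tau> + 1 \<Longrightarrow>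
          c * (b - a) \<le> measure (score_law r) {a<..<b}"
    and K: "K > 0" "K \<le> sqrt n" "2 \<le> c * K * sqrt n"
    and L: "24 * K + 4 \<le> L" "L + 1 \<le> 24 * sqrt n"
  shows "prob {\<omega> \<in> space M. (\<Sum>i=1..n. \<theta> i \<omega>) \<le> - sqrt (7 / 20 * n)} - 2 * exp (- (c * K)\<^sup>2 / 2)
      - 2 * (2 * L + 1) * exp (- c * sqrt n / 192) \<le>
    prob {\<omega> \<in> space M. c / 2304 / n \<le> selection_regret n (nat \<lfloor>\<alpha> * n\<rfloor>)
      (\<lambda>i. \<sigma> i \<omega>) (\<lambda>i. X i \<omega>) (\<eta> \<omega>) (\<pi>B \<omega>) (\<pi>E \<omega>)}"
proof -
  define w where "w = sqrt n"
  define m where "m = nat \<lfloor>\<alpha> * n\<rfloor>"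
  \<comment> \<open>With the gap d = 1/(3w) used below, \<open>h\<close> is d/8, half the length d/4
    of the windows to be counted; hence every such window contains a whole cell, wherever it
    starts.\<close>
  define h where "h = 1 / (24 * w)"
  \<comment> \<open>Moving from \<tau> by K/w changes the expected count by at least 2e. One half
    pays for the Hoeffding deviation; the other, being at least 1, absorbs the rounding in
    \<open>m\<close>.\<close>
  define e where "e = c * K * w / 2"
  define Q where "Q = (\<lambda>x. (measure (score_law 1) {x<..} + measure (score_law 2) {x<..}) / 2)"
  define cell where "cell = (\<lambda>j::int. {\<tau> + j * h<..<\<tau> + (j + 1) * h})"
  define E where "E = {\<omega> \<in> space M. (\<Sum>i=1..n. \<theta> i \<omega>) \<le> - sqrt (7 / 20 * n)}"
  define R where "R = {\<omega> \<in> space M. c / 2304 / n \<le> selection_regret n m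
      (\<lambda>i. \<sigma> i \<omega>) (\<lambda>i. X i \<omega>) (\<eta> \<omega>) (\<pi>B \<omega>) (\<pi>E \<omega>)}"
  define B1 where "B1 = {\<omega> \<in> space M. real (card {i \<in> {1..n}. \<tau> + K / w < \<theta> i \<omega>}) \<ge> n * Q (\<tau> + K / w) + e}"
  define B2 where "B2 = {\<omega> \<in> space M. real (card {i \<in> {1..n}. \<tau> - K / w < \<theta> i \<omega>}) \<le> n * Q (\<tau> - K / w) - e}"
  define B3 where "B3 = (\<lambda>(r, j). {\<omega> \<in> space M. real (card {i \<in> {1..n}. \<sigma> i \<omega> = r \<and> \<theta> i \<omega> \<in> cell j}) < n * (c * h / 2) / 4})"
  define T where "T = {1, 2 :: real} \<times> {- L..L}"
  interpret S: real_distribution "score_law r" for r by (rule real_distribution_score_law)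
  have w: "w > 0" "w * w = n" "w\<^sup>2 = n" using n by (simp_all add: w_def)
  have h: "h > 0" using w by (simp add: h_def)
  define k where "k = c * (K / w)"
  have Kw: "0 < K / w" "K / w \<le> 1" using K w by (simp_all add: w_def)
  have nh: "n * (c * h / 2) / 4 = c * w / 192"
    using w by (simp add: h_def divide_simps)

  have [measurable]: "\<And>i. i \<in> {1..n} \<Longrightarrow> X i \<in> borel_measurable M" by (rule measurable_X)
  have [measurable]: "\<pi>B \<in> M \<rightarrow>\<^sub>M count_space UNIV" "\<pi>E \<in> M \<rightarrow>\<^sub>M count_space UNIV"
    using ties by (auto simp: random_tie_break_def)
  \<comment> \<open>Maximality determines the estimator pointwise as a function of the data, which
    yields its measurability.\<close>
  have \<eta>: "\<eta> \<omega> = (\<Sum>i=1..n. \<theta> i \<omega>) / (\<Sum>i=1..n. 1 / (1 + (\<sigma> i \<omega>)\<^sup>2))" if "\<omega> \<in> space M" for \<omega>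
    using mle_eq_weighted_mean[OF n mle[OF that]] by (simp add: oracle_score_def)
  have "(\<lambda>\<omega>. (\<Sum>i=1..n. \<theta> i \<omega>) / (\<Sum>i=1..n. 1 / (1 + (\<sigma> i \<omega>)\<^sup>2))) \<in> borel_measurable M"
    by measurable
  then have [measurable]: "\<eta> \<in> borel_measurable M"
    by (subst measurable_cong[OF \<eta>])
  have [measurable]: "R \<in> events"
  proof -
    have [measurable]: "(\<lambda>\<omega>. selection_regret n m (\<lambda>i. \<sigma> i \<omega>) (\<lambda>i. X i \<omega>) (\<eta> \<omega>) (\<pi>B \<omega>) (\<pi>E \<omega>)) \<in> borel_measurable M"
      by (rule measurable_selection_regret) measurable
    show ?thesis unfolding R_def by measurable
  qed
  have [measurable]: "E \<in> events" unfolding E_def by measurable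
  have card_eq: "real (card {i \<in> {1..n}. P i}) = (\<Sum>i\<in>{1..n}. if P i then 1 else 0)" for P
    by (simp add: sum.If_cases Int_def)
  have [measurable]: "B1 \<in> events" "B2 \<in> events"
    unfolding B1_def B2_def card_eq by measurable
  have B3_events: "B3 ` T \<subseteq> events"
  proof
    fix S assume "S \<in> B3 ` T"
    then obtain r j where S: "S = B3 (r, j)" by auto
    have [measurable]: "cell j \<in> sets borel" by (simp add: cell_def)
    show "S \<in> events" unfolding S B3_def card_eq prod.case by measurable
  qed
  have fin_T: "finite T" by (simp add: T_def)

  have avg_le: "(x + y) / 2 \<le> z - a" if "a + x \<le> x'" "a + y \<le> y'" "x' + y' = 2 * z" for a x y z x' y' :: real
    using that by (simp add: field_simps)
  have avg_ge: "z + a \<le> (x + y) / 2" if "a + x' \<le> x" "a + y' \<le> y" "x' + y' = 2 * z" for a x y z x' y' :: real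
    using that by (simp add: field_simps)
  have Q1: "Q (\<tau> + K / w) \<le> \<alpha> - k"
  proof -
    have "k + measure (score_law r) {\<tau> + K / w<..} \<le> measure (score_law r) {\<tau><..}" if "r \<in> {1, 2}" for r
    proof -
      have "k + measure (score_law r) {\<tau> + K / w<..} \<le>
          measure (score_law r) {\<tau><..<\<tau> + K / w} + measure (score_law r) {\<tau> + K / w<..}"
        using c(2)[OF that, of \<tau> "\<tau> + K / w"] Kw by (simp add: k_def)
      also have "\<dots> = measure (score_law r) ({\<tau><..<\<tau> + K / w} \<union> {\<tau> + K / w<..})"
        by (rule S.finite_measure_Union[symmetric]) auto
      also have "\<dots> \<le> measure (score_law r) {\<tau><..}"
        using Kw by (intro S.finite_measure_mono) auto
      finally show ?thesis .
    qed
    from avg_le[OF this[OF insertI1] this[OF insertI2, OF singletonI] \<tau>] show ?thesis unfolding Q_def .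
  qed
  have Q2: "Q (\<tau> - K / w) \<ge> \<alpha> + k"
  proof -
    have "k + measure (score_law r) {\<tau><..} \<le> measure (score_law r) {\<tau> - K / w<..}" if "r \<in> {1, 2}" for r
    proof -
      have "k + measure (score_law r) {\<tau><..} \<le>
          measure (score_law r) {\<tau> - K / w<..<\<tau>} + measure (score_law r) {\<tau><..}"
        using c(2)[OF that, of "\<tau> - K / w" \<tau>] Kw by (simp add: k_def)
      also have "\<dots> = measure (score_law r) ({\<tau> - K / w<..<\<tau>} \<union> {\<tau><..})"
        by (rule S.finite_measure_Union[symmetric]) auto
      also have "\<dots> \<le> measure (score_law r) {\<tau> - K / w<..}"
        using Kw by (intro S.finite_measure_mono) auto
      finally show ?thesis .
    qed
    from avg_ge[OF this[OF insertI1] this[OF insertI2, OF singletonI] \<tau>] show ?thesis unfolding Q_def .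
  qed
  have nK: "n * (k) = 2 * e"
    using w by (simp add: e_def k_def field_simps)
  have "e \<ge> 1" using K by (simp add: e_def w_def)

  have "AE \<omega> in M. \<omega> \<in> E \<longrightarrow> \<omega> \<in> R \<union> (B1 \<union> (B2 \<union> (\<Union>p\<in>T. B3 p)))"
  proof -
    have "AE \<omega> in M. \<pi>B \<omega> permutes {1..n}" "AE \<omega> in M. \<pi>E \<omega> permutes {1..n}"
      by (rule random_tie_break_permutes[OF ties(1)] random_tie_break_permutes[OF ties(2)];
          rule measurable_\<mu> measurable_\<sigma> measurable_X; assumption)+
    then show ?thesis using AE_\<sigma>
    proof eventually_elim
      case (elim \<omega>)
      show ?case
      proof (intro impI, rule ccontr)
        assume "\<omega> \<in> E" and *: "\<omega> \<notin> R \<union> (B1 \<union> (B2 \<union> (\<Union>p\<in>T. B3 p)))"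
        have \<omega>: "\<omega> \<in> space M" and S: "(\<Sum>i=1..n. \<theta> i \<omega>) \<le> - sqrt (7 / 20 * n)"
          using \<open>\<omega> \<in> E\<close> by (auto simp: E_def)
        \<comment> \<open>The gap is d = 1/(3w) and the guaranteed count per cell is cw/192; the
          product with the factor 1/4 gives the constant, since 3 * 192 * 4 = 2304.\<close>
        have "1 / (3 * w) * (c * w / 192) / 4 / n \<le>
            selection_regret n m (\<lambda>i. \<sigma> i \<omega>) (\<lambda>i. X i \<omega>) (\<eta> \<omega>) (\<pi>B \<omega>) (\<pi>E \<omega>)"
        proof (rule selection_regret_ge[where a = "\<tau> - K / w" and b = "\<tau> + K / w"])
          show "1 \<le> m" using \<alpha> by (simp add: m_def le_nat_iff le_floor_iff)
          have "\<alpha> * n \<le> n" using \<alpha> by (simp add: mult_left_le_one_le)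
          then show "m \<le> n" unfolding m_def by linarith
          show "inj_on (\<pi>B \<omega>) {1..n}" "inj_on (\<pi>E \<omega>) {1..n}"
            using elim by (auto intro: permutes_inj_on)
          show "\<sigma> i \<omega> \<in> {1, 2}" if "i \<in> {1..n}" for i using elim that by blast
          show "1 / (3 * w) > 0" using w by simp
          have m_bounds: "\<alpha> * n - 1 < m" "m \<le> \<alpha> * n"
            using \<alpha> unfolding m_def by linarith+
          have "real (card {i \<in> {1..n}. \<tau> + K / w < \<theta> i \<omega>}) < n * Q (\<tau> + K / w) + e"
            using * \<omega> by (auto simp: B1_def not_le)
          also have "\<dots> \<le> n * (\<alpha> - k) + e"
            using Q1 by (intro add_right_mono mult_left_mono) auto
          also have "\<dots> < m"
            using nK \<open>e \<ge> 1\<close> m_bounds by (simp add: right_diff_distrib mult.commute)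
          finally show "card {i \<in> {1..n}. \<tau> + K / w < posterior_mean 0 (\<sigma> i \<omega>) (X i \<omega>)} < m"
            by (simp add: oracle_score_def)
          have "m \<le> n * (\<alpha> + k) - e"
            using nK \<open>e \<ge> 1\<close> m_bounds by (simp add: distrib_left mult.commute)
          also have "\<dots> \<le> n * Q (\<tau> - K / w) - e"
            using Q2 by (intro diff_right_mono mult_left_mono) auto
          also have "\<dots> < real (card {i \<in> {1..n}. \<tau> - K / w < \<theta> i \<omega>})"
            using * \<omega> by (auto simp: B2_def not_le)
          finally show "m \<le> card {i \<in> {1..n}. \<tau> - K / w < posterior_mean 0 (\<sigma> i \<omega>) (X i \<omega>)}"
            by (simp add: oracle_score_def)
          \<comment> \<open>Each weight is at most 1/2, so W \<le> n/2, and the sum of scores is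
            negative: a smaller W only pushes the quotient further down. With 5/9 \<le> sqrt(7/20)
            this gives 2 * 5/9 = 10/9 = 10/3 * 1/3.\<close>
          show "\<eta> \<omega> \<le> - 10 / 3 * (1 / (3 * w))"
          proof -
            define W where "W = (\<Sum>i=1..n. 1 / (1 + (\<sigma> i \<omega>)\<^sup>2))"
            have "W \<le> (\<Sum>i=1..n. 1 / 2)"
              unfolding W_def using elim by (intro sum_mono) fastforce
            then have "W \<le> n / 2" by simp
            have "W > 0"
              unfolding W_def using n by (intro sum_pos) (auto simp: add_pos_nonneg)
            have "5 / 9 \<le> sqrt (7 / 20)" by (rule real_le_rsqrt) (simp add: power2_eq_square)
            then have "5 / 9 * w \<le> sqrt (7 / 20 * n)"
              unfolding real_sqrt_mult w_def[symmetric] using w by (intro mult_right_mono) simp_all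
            have "10 / 3 * (1 / (3 * w)) * W \<le> 10 / 3 * (1 / (3 * w)) * (n / 2)"
              using \<open>W \<le> n / 2\<close> w by (intro mult_left_mono) auto
            also have "\<dots> = 5 / 9 * w"
              using w by (simp add: field_simps)
            also have "\<dots> \<le> sqrt (7 / 20 * n)" by fact
            finally have "(\<Sum>i=1..n. \<theta> i \<omega>) \<le> - 10 / 3 * (1 / (3 * w)) * W"
              using S by simp
            then show ?thesis
              unfolding \<eta>[OF \<omega>] W_def[symmetric] pos_divide_le_eq[OF \<open>W > 0\<close>] .
          qed
          fix r y :: real assume r: "r \<in> {1, 2}"
            and y: "\<tau> - K / w - 1 / (3 * w) / 2 \<le> y" "y \<le> \<tau> + K / w + 1 / (3 * w) / 4"
          \<comment> \<open>The first grid point not to the left of \<open>y\<close>. In units of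
            \<open>h\<close> the distances K/w, d/2 and d/4 are 24K, 4 and 2, so the index lies
            between -(24K + 4) and 24K + 3, which is the range that \<open>L\<close> has to
            cover.\<close>
          define j where "j = \<lceil>(y - \<tau>) / h\<rceil>"
          have eqs: "K / w = 24 * K * h" "1 / (3 * w) / 2 = 4 * h" "1 / (3 * w) / 4 = 2 * h"
            by (simp_all add: h_def)
          have "(- (24 * K) - 4) * h \<le> y - \<tau>" "y - \<tau> \<le> (24 * K + 2) * h"
            using y unfolding eqs by (simp_all add: algebra_simps)
          then have "- (24 * K) - 4 \<le> (y - \<tau>) / h" "(y - \<tau>) / h \<le> 24 * K + 2"
            by (simp_all only: pos_le_divide_eq[OF h] pos_divide_le_eq[OF h])
          then have "j \<in> {- L..L}"
            using L(1) unfolding j_def by (simp, linarith)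
          then have "\<omega> \<notin> B3 (r, j)" using * r by (auto simp: T_def)
          then have "c * w / 192 \<le> real (card {i \<in> {1..n}. \<sigma> i \<omega> = r \<and> \<theta> i \<omega> \<in> cell j})"
            using \<omega> unfolding B3_def nh prod.case by (simp only: mem_Collect_eq simp_thms not_less)
          also have "\<dots> \<le> real (card {i \<in> {1..n}. \<sigma> i \<omega> = r \<and> \<theta> i \<omega> \<in> {y<..<y + 1 / (3 * w) / 4}})"
          proof -
            have "(y - \<tau>) / h \<le> j" "j < (y - \<tau>) / h + 1" unfolding j_def by linarith+
            then have "y \<le> \<tau> + j * h" "\<tau> + (j + 1) * h \<le> y + 2 * h"
              using h by (simp_all add: field_simps)
            moreover have "1 / (3 * w) / 4 = 2 * h" by (simp add: h_def)
            ultimately have "cell j \<subseteq> {y<..<y + 1 / (3 * w) / 4}" by (auto simp: cell_def)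
            then have "{i \<in> {1..n}. \<sigma> i \<omega> = r \<and> \<theta> i \<omega> \<in> cell j} \<subseteq>
                {i \<in> {1..n}. \<sigma> i \<omega> = r \<and> \<theta> i \<omega> \<in> {y<..<y + 1 / (3 * w) / 4}}" by blast
            then show ?thesis by (intro of_nat_mono card_mono) auto
          qed
          finally show "c * w / 192 \<le> real (card {i \<in> {1..n}. \<sigma> i \<omega> = r \<and>
              posterior_mean 0 (\<sigma> i \<omega>) (X i \<omega>) \<in> {y<..<y + 1 / (3 * w) / 4}})"
            by (simp only: oracle_score_def)
        qed
        moreover have "1 / (3 * w) * (c * w / 192) / 4 / n = c / 2304 / n"
          using w by simp
        ultimately show False using * \<omega> by (simp add: R_def)
      qed
    qed
  qed
  then have "prob E \<le> prob (R \<union> (B1 \<union> (B2 \<union> (\<Union>p\<in>T. B3 p))))"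
    using B3_events fin_T by (intro finite_measure_mono_AE) (auto intro!: sets.Un sets.finite_UN)
  also have "\<dots> \<le> prob R + (prob B1 + (prob B2 + prob (\<Union>p\<in>T. B3 p)))"
    using B3_events fin_T
    by (intro order_trans[OF measure_Un_le] add_mono order_refl) (auto intro!: sets.Un sets.finite_UN)
  also have "prob (\<Union>p\<in>T. B3 p) \<le> (\<Sum>p\<in>T. prob (B3 p))"
    using B3_events fin_T by (intro finite_measure_subadditive_finite)
  also have "\<dots> \<le> (\<Sum>p\<in>T. exp (- c * w / 192))"
  proof (rule sum_mono)
    fix p assume "p \<in> T"
    then obtain r j where p: "p = (r, j)" "r \<in> {1, 2}" "- L \<le> j" "j \<le> L" by (auto simp: T_def)
    \<comment> \<open>All cells stay within distance 1 of \<tau>, where the lower bound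
      \<open>c\<close> on the density is available.\<close>
    have "(real_of_int L + 1) * h \<le> 1" using L(2) w by (simp add: h_def w_def field_simps)
    moreover have "- real_of_int L * h \<le> j * h" "(real_of_int j + 1) * h \<le> (real_of_int L + 1) * h"
      using p h by (intro mult_right_mono; simp)+
    moreover have "(real_of_int L + 1) * h = real_of_int L * h + h" "(real_of_int j + 1) * h = real_of_int j * h + h"
      by (simp_all add: algebra_simps)
    ultimately have "- 1 \<le> j * h" "(real_of_int j + 1) * h \<le> 1" "j * h \<le> (real_of_int j + 1) * h"
      using h by linarith+
    then have "c * (\<tau> + (real_of_int j + 1) * h - (\<tau> + j * h)) \<le> measure (score_law r) (cell j)"
      unfolding cell_def using p by (intro c(2)) auto
    then have "2 * (c * h / 2) \<le> measure (score_law r) (cell j)"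
      by (simp add: algebra_simps)
    then have "prob (B3 p) \<le> exp (- n * (c * h / 2) / 4)"
      unfolding p B3_def prod.case using p by (intro Chernoff_\<sigma>_\<theta>) (auto simp: cell_def)
    also have "- n * (c * h / 2) / 4 = - c * w / 192" using nh by simp
    finally show "prob (B3 p) \<le> exp (- c * w / 192)" .
  qed
  also have "\<dots> = 2 * (2 * L + 1) * exp (- c * w / 192)"
  proof -
    have "L \<ge> 0" using L(1) K by linarith
    then show ?thesis by (simp add: T_def card_cartesian_product)
  qed
  finally have bound: "prob E \<le> prob R + (prob B1 + (prob B2 + 2 * (2 * L + 1) * exp (- c * w / 192)))"
    by simp
  \<comment> \<open>The sample size cancels, so this part of the failure probability is controlled
    by \<open>K\<close> alone.\<close>
  have "- 2 * e\<^sup>2 / n = - (c * K)\<^sup>2 / 2"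
    using w n by (simp add: e_def power_mult_distrib power_divide)
  moreover have "prob B1 \<le> exp (- 2 * e\<^sup>2 / n)" "prob B2 \<le> exp (- 2 * e\<^sup>2 / n)"
    unfolding B1_def B2_def Q_def using n \<open>e \<ge> 1\<close> by (intro Hoeffding_\<theta>; simp)+
  ultimately have "prob B1 \<le> exp (- (c * K)\<^sup>2 / 2)" "prob B2 \<le> exp (- (c * K)\<^sup>2 / 2)" by (simp_all only:)
  with bound show ?thesis unfolding E_def R_def m_def w_def by simp
qed

end

theorem mainTheorem2:
  fixes \<alpha> :: real
    and M :: "nat \<Rightarrow> 'a measure"
    and \<mu> \<sigma> X :: "nat \<Rightarrow> nat \<Rightarrow> 'a \<Rightarrow> real"
    and \<eta>_hat :: "nat \<Rightarrow> 'a \<Rightarrow> real"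
    and \<pi>B \<pi>E :: "nat \<Rightarrow> 'a \<Rightarrow> nat \<Rightarrow> nat"
  assumes "0 < \<alpha>" "\<alpha> < 1"
    and "\<And>n. n \<ge> 1 \<Longrightarrow> normal_means_model (M n) n (\<mu> n) (\<sigma> n) (X n)"
    and "\<And>n \<omega>. n \<ge> 1 \<Longrightarrow> \<omega> \<in> space (M n) \<Longrightarrow>
           is_mle n (\<lambda>i. \<sigma> n i \<omega>) (\<lambda>i. X n i \<omega>) (\<eta>_hat n \<omega>)"
    and "\<And>n. n \<ge> 1 \<Longrightarrow> random_tie_break (M n) n (\<mu> n) (\<sigma> n) (X n) (\<pi>B n)"
    and "\<And>n. n \<ge> 1 \<Longrightarrow> random_tie_break (M n) n (\<mu> n) (\<sigma> n) (X n) (\<pi>E n)"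
  shows "\<exists>C>0. liminf (\<lambda>n. ereal (measure (M n)
           {\<omega> \<in> space (M n).
              selection_regret n (nat \<lfloor>\<alpha> * real n\<rfloor>)
                (\<lambda>i. \<sigma> n i \<omega>) (\<lambda>i. X n i \<omega>) (\<eta>_hat n \<omega>) (\<pi>B n \<omega>) (\<pi>E n \<omega>)
              \<ge> C / real n})) > 0"
proof -
  define p where "p = cdf std_normal_distribution (- 1)"
  have "p > 0" unfolding p_def by (rule cdf_std_normal_pos)
  obtain \<tau> where \<tau>: "measure (score_law 1) {\<tau><..} + measure (score_law 2) {\<tau><..} = 2 * \<alpha>"
    using score_quantile_exists[OF assms(1,2)] by blast
  obtain c1 where c1: "c1 > 0"
    "\<And>a b. \<tau> - 1 \<le> a \<Longrightarrow> a \<le> b \<Longrightarrow> b \<le> \<tau> + 1 \<Longrightarrow> c1 * (b - a) \<le> measure (score_law 1) {a<..<b}"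
    by (rule score_law_Ioo_ge[of \<tau> 1]) blast
  obtain c2 where c2: "c2 > 0"
    "\<And>a b. \<tau> - 1 \<le> a \<Longrightarrow> a \<le> b \<Longrightarrow> b \<le> \<tau> + 1 \<Longrightarrow> c2 * (b - a) \<le> measure (score_law 2) {a<..<b}"
    by (rule score_law_Ioo_ge[of \<tau> 2]) blast
  define c where "c = min c1 c2"
  have "c > 0" using c1(1) c2(1) by (simp add: c_def)
  have c: "c * (b - a) \<le> measure (score_law r) {a<..<b}"
    if "r \<in> {1, 2}" "\<tau> - 1 \<le> a" "a \<le> b" "b \<le> \<tau> + 1" for r a b
  proof -
    have "c * (b - a) \<le> c1 * (b - a)" "c * (b - a) \<le> c2 * (b - a)"
      using that by (auto simp: c_def intro!: mult_right_mono)
    then show ?thesis using c1(2)[of a b] c2(2)[of a b] that by auto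
  qed
  \<comment> \<open>The budget is p/4 for each kind of failure against an event of probability above
    3p/4, which leaves p/4. \<open>K\<close> is fixed before n because its failure bound does not
    depend on n; \<open>L\<close> depends on \<open>K\<close> only, so the bound for the cells
    vanishes as n grows.\<close>
  have "((\<lambda>K. 2 * exp (- (c * K)\<^sup>2 / 2)) \<longlongrightarrow> 0) at_top"
    using \<open>c > 0\<close> by real_asymp
  then have "eventually (\<lambda>K. 2 * exp (- (c * K)\<^sup>2 / 2) < p / 4) at_top"
    by (rule order_tendstoD) (use \<open>p > 0\<close> in simp)
  then have "eventually (\<lambda>K. K > 0 \<and> 2 * exp (- (c * K)\<^sup>2 / 2) < p / 4) at_top"
    using eventually_gt_at_top[of 0] by eventually_elim simp
  then obtain K where K: "K > 0" "2 * exp (- (c * K)\<^sup>2 / 2) < p / 4"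
    unfolding eventually_at_top_linorder by blast
  define L where "L = \<lceil>24 * K + 4\<rceil>"
  define l where "l = real_of_int L"
  have "(\<lambda>n. 2 * (2 * l + 1) * exp (- c * sqrt (real n) / 192)) \<longlonglongrightarrow> 0"
    using \<open>c > 0\<close> by real_asymp
  then have ev1: "eventually (\<lambda>n. 2 * (2 * l + 1) * exp (- c * sqrt (real n) / 192) < p / 4) sequentially"
    by (rule order_tendstoD) (use \<open>p > 0\<close> in simp)
  have ev2: "eventually (\<lambda>n. 3 / 4 * p < measure (M n)
      {\<omega> \<in> space (M n). (\<Sum>i=1..n. oracle_score (\<sigma> n) (X n) i \<omega>) \<le> - sqrt (7 / 20 * n)}) sequentially"
    by (rule order_tendstoD[OF sum_scores_CLT[where \<mu> = \<mu>]], rule assms(3))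
      (use \<open>p > 0\<close> in \<open>simp_all add: p_def[symmetric]\<close>)
  \<comment> \<open>The condition \<open>2 \<le> c * K * sqrt n\<close> makes the deviation
    \<open>e\<close> at least 1, \<open>1 \<le> \<alpha> * n\<close> makes \<open>m\<close>
    positive, and the bounds on \<open>K\<close> and \<open>l\<close> keep the localising points and
    the cells near the quantile.\<close>
  have ev3: "eventually (\<lambda>n. n \<ge> 1 \<and> 1 \<le> \<alpha> * real n \<and> K \<le> sqrt (real n) \<and> 2 \<le> c * K * sqrt (real n) \<and>
      l + 1 \<le> 24 * sqrt (real n)) sequentially"
  proof -
    have "filterlim (\<lambda>n. sqrt (real n)) at_top sequentially" by real_asymp
    then have "eventually (\<lambda>n. max K (max (2 / (c * K)) ((l + 1) / 24)) \<le> sqrt (real n)) sequentially"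
      by (simp only: filterlim_at_top)
    then show ?thesis
      using eventually_ge_at_top[of "max 1 (nat \<lceil>1 / \<alpha>\<rceil>)"]
    proof eventually_elim
      case (elim n)
      then have "1 / \<alpha> \<le> n" by linarith
      with elim show ?case
        using assms(1) \<open>c > 0\<close> K(1) by (auto simp: field_simps)
    qed
  qed
  have "eventually (\<lambda>n. ereal (p / 4) \<le> ereal (measure (M n)
           {\<omega> \<in> space (M n).
              selection_regret n (nat \<lfloor>\<alpha> * real n\<rfloor>)
                (\<lambda>i. \<sigma> n i \<omega>) (\<lambda>i. X n i \<omega>) (\<eta>_hat n \<omega>) (\<pi>B n \<omega>) (\<pi>E n \<omega>)
              \<ge> c / 2304 / real n})) sequentially"
    using ev1 ev2 ev3
  proof eventually_elim
    case (elim n)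
    interpret normal_means_model "M n" n "\<mu> n" "\<sigma> n" "X n"
      using elim by (intro assms(3)) auto
    have "24 * K + 4 \<le> real_of_int L" unfolding L_def by linarith
    then have "prob {\<omega> \<in> space (M n). (\<Sum>i=1..n. \<theta> i \<omega>) \<le> - sqrt (7 / 20 * n)} - 2 * exp (- (c * K)\<^sup>2 / 2)
      - 2 * (2 * L + 1) * exp (- c * sqrt n / 192) \<le>
      prob {\<omega> \<in> space (M n). c / 2304 / n \<le> selection_regret n (nat \<lfloor>\<alpha> * n\<rfloor>)
        (\<lambda>i. \<sigma> n i \<omega>) (\<lambda>i. X n i \<omega>) (\<eta>_hat n \<omega>) (\<pi>B n \<omega>) (\<pi>E n \<omega>)}"
      using elim by (intro prob_selection_regret_ge[where \<tau> = \<tau>] assms \<tau> \<open>c > 0\<close> c K(1)) (auto simp: l_def)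
    then show ?case using elim K(2) by (simp add: l_def)
  qed
  then have "ereal (p / 4) \<le> liminf (\<lambda>n. ereal (measure (M n)
           {\<omega> \<in> space (M n).
              selection_regret n (nat \<lfloor>\<alpha> * real n\<rfloor>)
                (\<lambda>i. \<sigma> n i \<omega>) (\<lambda>i. X n i \<omega>) (\<eta>_hat n \<omega>) (\<pi>B n \<omega>) (\<pi>E n \<omega>)
              \<ge> c / 2304 / real n}))"
    by (rule Liminf_bounded)
  moreover have "0 < ereal (p / 4)" using \<open>p > 0\<close> by simp
  ultimately have "0 < liminf (\<lambda>n. ereal (measure (M n)
           {\<omega> \<in> space (M n).
              selection_regret n (nat \<lfloor>\<alpha> * real n\<rfloor>)
                (\<lambda>i. \<sigma> n i \<omega>) (\<lambda>i. X n i \<omega>) (\<eta>_hat n \<omega>) (\<pi>B n \<omega>) (\<pi>E n \<omega>)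
              \<ge> c / 2304 / real n}))"
    by (rule less_le_trans[rotated])
  then show ?thesis
    using \<open>c > 0\<close> by (intro exI[of _ "c / 2304"]) simp
qed

end
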